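(* Let $\mathbf{D}$ be a generalized divergence and $\mathbf{R}$ the associated generalized Rains information of bipartite channels. Let $\mathcal{M}_{\hat A'\hat B'\to\hat A\hat B}$ be a bipartite quantum channel and $\Theta^{\mathrm{PPT}}$ a completely-PPT-preserving superchannel, $\Theta^{\mathrm{PPT}}(\mathcal{M})=\mathcal{P}^{\mathrm{post}}_{A_M\hat A\hat BB_M\to AB}\circ\mathcal{M}\circ\mathcal{P}^{\mathrm{pre}}_{A'B'\to\hat A'\hat B'A_MB_M}$ with $\mathcal{P}^{\mathrm{pre}},\mathcal{P}^{\mathrm{post}}$ completely PPT-preserving. Then $$\mathbf{R}(\mathcal{M})\ge\mathbf{R}(\Theta^{\mathrm{PPT}}(\mathcal{M})).$$
   Context: A generalized divergence $\mathbf{D}(\rho\|\sigma)$ (for a state $\rho$ and positive semidefinite $\sigma$) is any function satisfying data processing $\mathbf{D}(\rho\|\sigma)\ge\mathbf{D}(\mathcal{E}(\rho)\|\mathcal{E}(\sigma))$ for all quantum channels $\mathcal{E}$. The generalized channel divergence of a channel $\mathcal{N}_{C\to D}$ and a completely positive map $\mathcal{M}_{C\to D}$ is $\mathbf{D}(\mathcal{N}\|\mathcal{M})=\sup_{\psi_{RC}}\mathbf{D}(\mathcal{N}(\psi_{RC})\|\mathcal{M}(\psi_{RC}))$ over pure states with $R\simeq C$. For a bipartite map $\mathcal{M}_{A'B'\to AB}$ (Alice: $A',A$; Bob: $B',B$), $E_N(\mathcal{M})=\log\|T_B\circ\mathcal{M}\circ T_{B'}\|_\diamond$, $T_X$ the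 partial transpose. The generalized Rains information of a bipartite channel $\mathcal{N}$ is $\mathbf{R}(\mathcal{N})=\inf_{\mathcal{M}:E_N(\mathcal{M})\le 0}\mathbf{D}(\mathcal{N}\|\mathcal{M})$, infimum over completely positive bipartite maps $\mathcal{M}_{A'B'\to AB}$. A bipartite channel is completely PPT-preserving if conjugating it with partial transposes on Bob's input and output systems yields a completely positive map. In the superchannel, Alice holds $A',\hat A',A_M,\hat A,A$; Bob holds $B',\hat B',B_M,\hat B,B$. *)

theory Defs
  imports Complex_Main "HOL-Library.Nat_Bijection" "HOL-Library.Extended_Real"
begin

text \<open>
Finite-dimensional quantum systems are modelled by finite sets of basis labels in the
universal countable label type nat.  An operator is a complex matrix indexed by labels,
an operator on the system S is one supported on S x S.  The composite system S (x) T has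
basis labels prod_encode (s,t), with prod_encode a bijection nat x nat -> nat; the first
tensor factor is always Alice's (or the reference), the second one Bob's (or the system).
\<close>

type_synonym op = "nat \<Rightarrow> nat \<Rightarrow> complex"
type_synonym qmap = "op \<Rightarrow> op"

definition pe :: "nat \<Rightarrow> nat \<Rightarrow> nat" where
  "pe i j = prod_encode (i, j)"

definition sys_tensor :: "nat set \<Rightarrow> nat set \<Rightarrow> nat set" (infixr \<open>\<otimes>\<^sub>s\<close> 70) where
  "S \<otimes>\<^sub>s T = (\<lambda>(i, j). prod_encode (i, j)) ` (S \<times> T)"

definition op_on :: "nat set \<Rightarrow> op \<Rightarrow> bool" where
  "op_on S X \<longleftrightarrow> (\<forall>i j. i \<notin> S \<or> j \<notin> S \<longrightarrow> X i j = 0)"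

definition trace :: "nat set \<Rightarrow> op \<Rightarrow> complex" where
  "trace S X = (\<Sum>i\<in>S. X i i)"

definition psd :: "nat set \<Rightarrow> op \<Rightarrow> bool" where
  "psd S X \<longleftrightarrow> op_on S X \<and>
     (\<forall>v :: nat \<Rightarrow> complex. let q = (\<Sum>i\<in>S. \<Sum>j\<in>S. cnj (v i) * X i j * v j)
                            in Im q = 0 \<and> Re q \<ge> 0)"

definition is_state :: "nat set \<Rightarrow> op \<Rightarrow> bool" where
  "is_state S \<rho> \<longleftrightarrow> psd S \<rho> \<and> trace S \<rho> = 1"

definition pure_state :: "nat set \<Rightarrow> op \<Rightarrow> bool" where
  "pure_state S \<psi> \<longleftrightarrow> (\<exists>v :: nat \<Rightarrow> complex. (\<Sum>i\<in>S. (cmod (v i))\<^sup>2) = 1 \<and>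
      \<psi> = (\<lambda>i j. if i \<in> S \<and> j \<in> S then v i * cnj (v j) else 0))"

definition is_map :: "nat set \<Rightarrow> nat set \<Rightarrow> qmap \<Rightarrow> bool" where
  "is_map S T E \<longleftrightarrow>
     (\<forall>X. op_on S X \<longrightarrow> op_on T (E X)) \<and>
     (\<forall>X Y. op_on S X \<longrightarrow> op_on S Y \<longrightarrow>
        E (\<lambda>i j. X i j + Y i j) = (\<lambda>i j. E X i j + E Y i j)) \<and>
     (\<forall>c X. op_on S X \<longrightarrow> E (\<lambda>i j. c * X i j) = (\<lambda>i j. c * E X i j))"

definition idt :: "nat set \<Rightarrow> qmap \<Rightarrow> qmap" where
  "idt R E X = (\<lambda>m n. case prod_decode m of (r, b) \<Rightarrow> case prod_decode n of (r', b') \<Rightarrow>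
      if r \<in> R \<and> r' \<in> R then E (\<lambda>a a'. X (pe r a) (pe r' a')) b b' else 0)"

definition CP :: "nat set \<Rightarrow> nat set \<Rightarrow> qmap \<Rightarrow> bool" where
  "CP S T E \<longleftrightarrow> is_map S T E \<and>
     (\<forall>R X. finite R \<longrightarrow> psd (R \<otimes>\<^sub>s S) X \<longrightarrow> psd (R \<otimes>\<^sub>s T) (idt R E X))"

definition TP :: "nat set \<Rightarrow> nat set \<Rightarrow> qmap \<Rightarrow> bool" where
  "TP S T E \<longleftrightarrow> (\<forall>X. op_on S X \<longrightarrow> trace T (E X) = trace S X)"

definition channel :: "nat set \<Rightarrow> nat set \<Rightarrow> qmap \<Rightarrow> bool" where
  "channel S T E \<longleftrightarrow> CP S T E \<and> TP S T E"

definition gen_divergence :: "(nat set \<Rightarrow> op \<Rightarrow> op \<Rightarrow> ereal) \<Rightarrow> bool" where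
  "gen_divergence D \<longleftrightarrow>
     (\<forall>S T E \<rho> \<sigma>. finite S \<longrightarrow> finite T \<longrightarrow> channel S T E \<longrightarrow> is_state S \<rho> \<longrightarrow> psd S \<sigma> \<longrightarrow>
        D T (E \<rho>) (E \<sigma>) \<le> D S \<rho> \<sigma>)"

definition chan_div :: "(nat set \<Rightarrow> op \<Rightarrow> op \<Rightarrow> ereal) \<Rightarrow> nat set \<Rightarrow> nat set \<Rightarrow> qmap \<Rightarrow> qmap \<Rightarrow> ereal" where
  "chan_div D C Dd N M =
     (SUP \<psi> \<in> {\<psi>. pure_state (C \<otimes>\<^sub>s C) \<psi>}. D (C \<otimes>\<^sub>s Dd) (idt C N \<psi>) (idt C M \<psi>))"

definition matmul :: "nat set \<Rightarrow> op \<Rightarrow> op \<Rightarrow> op" where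
  "matmul S X Y = (\<lambda>i j. \<Sum>k\<in>S. X i k * Y k j)"

definition adj :: "op \<Rightarrow> op" where
  "adj X = (\<lambda>i j. cnj (X j i))"

definition idop :: "nat set \<Rightarrow> op" where
  "idop S = (\<lambda>i j. if i = j \<and> i \<in> S then 1 else 0)"

definition unitary :: "nat set \<Rightarrow> op \<Rightarrow> bool" where
  "unitary S U \<longleftrightarrow> op_on S U \<and> matmul S U (adj U) = idop S"

text \<open>Trace norm ||X||_1 = Tr|X| = max over unitaries U of |Tr(U X)|.\<close>
definition trace_norm :: "nat set \<Rightarrow> op \<Rightarrow> real" where
  "trace_norm S X = (SUP U \<in> {U. unitary S U}. cmod (trace S (matmul S U X)))"

definition diamond_norm :: "nat set \<Rightarrow> nat set \<Rightarrow> qmap \<Rightarrow> real" where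
  "diamond_norm S T \<Phi> =
     (SUP X \<in> {X. op_on (S \<otimes>\<^sub>s S) X \<and> trace_norm (S \<otimes>\<^sub>s S) X \<le> 1}.
        trace_norm (S \<otimes>\<^sub>s T) (idt S \<Phi> X))"

definition ptB :: "op \<Rightarrow> op" where
  "ptB X = (\<lambda>m n. case prod_decode m of (a, b) \<Rightarrow> case prod_decode n of (a', b') \<Rightarrow>
      X (pe a b') (pe a' b))"

definition log_neg :: "nat set \<Rightarrow> nat set \<Rightarrow> nat set \<Rightarrow> nat set \<Rightarrow> qmap \<Rightarrow> real" where
  "log_neg A' B' A B M = log 2 (diamond_norm (A' \<otimes>\<^sub>s B') (A \<otimes>\<^sub>s B) (ptB \<circ> M \<circ> ptB))"

definition rains :: "(nat set \<Rightarrow> op \<Rightarrow> op \<Rightarrow> ereal) \<Rightarrow> nat set \<Rightarrow> nat set \<Rightarrow> nat set \<Rightarrow> nat set \<Rightarrow> qmap \<Rightarrow> ereal" where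
  "rains D A' B' A B N =
     (INF M \<in> {M. CP (A' \<otimes>\<^sub>s B') (A \<otimes>\<^sub>s B) M \<and> log_neg A' B' A B M \<le> 0}.
        chan_div D (A' \<otimes>\<^sub>s B') (A \<otimes>\<^sub>s B) N M)"

definition bipartite_channel :: "nat set \<Rightarrow> nat set \<Rightarrow> nat set \<Rightarrow> nat set \<Rightarrow> qmap \<Rightarrow> bool" where
  "bipartite_channel A' B' A B N \<longleftrightarrow> channel (A' \<otimes>\<^sub>s B') (A \<otimes>\<^sub>s B) N"

definition completely_PPT_preserving :: "nat set \<Rightarrow> nat set \<Rightarrow> nat set \<Rightarrow> nat set \<Rightarrow> qmap \<Rightarrow> bool" where
  "completely_PPT_preserving A' B' A B P \<longleftrightarrow>
     bipartite_channel A' B' A B P \<and> CP (A' \<otimes>\<^sub>s B') (A \<otimes>\<^sub>s B) (ptB \<circ> P \<circ> ptB)"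

text \<open>id_{A_M B_M} (x) M, mapping operators on (Ah' (x) A_M) (x) (Bh' (x) B_M)
  to operators on (Ah (x) A_M) (x) (Bh (x) B_M), where M : Ah' Bh' -> Ah Bh.\<close>
definition lift_mid :: "nat set \<Rightarrow> nat set \<Rightarrow> qmap \<Rightarrow> qmap" where
  "lift_mid AM BM M X = (\<lambda>m n.
     case prod_decode m of (\<alpha>, \<beta>) \<Rightarrow> case prod_decode n of (\<alpha>', \<beta>') \<Rightarrow>
     case prod_decode \<alpha> of (a, am) \<Rightarrow> case prod_decode \<beta> of (b, bm) \<Rightarrow>
     case prod_decode \<alpha>' of (a', am') \<Rightarrow> case prod_decode \<beta>' of (b', bm') \<Rightarrow>
     if am \<in> AM \<and> bm \<in> BM \<and> am' \<in> AM \<and> bm' \<in> BM then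
       M (\<lambda>p q. case prod_decode p of (x, y) \<Rightarrow> case prod_decode q of (x', y') \<Rightarrow>
            X (pe (pe x am) (pe y bm)) (pe (pe x' am') (pe y' bm'))) (pe a b) (pe a' b')
     else 0)"

definition superchannel_apply :: "qmap \<Rightarrow> qmap \<Rightarrow> nat set \<Rightarrow> nat set \<Rightarrow> qmap \<Rightarrow> qmap" where
  "superchannel_apply Ppre Ppost AM BM M = Ppost \<circ> lift_mid AM BM M \<circ> Ppre"

end

theory Submission
  imports Defs "HOL-Analysis.Function_Topology" "HOL-Analysis.Topology_Euclidean_Space"
begin

text \<open>
A feasible map \<open>M'\<close> for the Rains information of \<open>M\<close> is sent by the superchannel to a feasible map
for the transformed channel.  Conjugation by partial transposes passes through the composition, and
it turns \<open>Ppre\<close> and \<open>Ppost\<close> into channels; these contract the trace norm, and a map of diamond norm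
at most one contracts it in the presence of any reference system, because a vector on \<open>R \<otimes> S\<close>
is the image, under a partial isometry on the reference, of a vector on \<open>S \<otimes> S\<close>.

The channel divergence does not increase either: after \<open>Ppre\<close>, a test state becomes a mixed state on
\<open>R \<otimes> C\<close> with \<open>R\<close> containing the memory systems.  It is the image of a pure state on \<open>C \<otimes> C\<close>
under a channel on the reference, so data processing applies to this channel followed by \<open>Ppost\<close>.

Trace norm estimates go through rank-one operators.  A unitary \<open>U\<close> maximizing \<open>Re (Tr (U X))\<close> exists
by compactness and makes \<open>X U\<close> positive; a Gram decomposition of \<open>X U\<close> then writes \<open>X\<close> as a sum of
rank-one operators of total size equal to the trace norm of \<open>X\<close>.
\<close>

text \<open>The suprema in the channel divergence and in the diamond norm both range over a
  reference of the same size as the input, whereas after \<open>Ppre\<close> the middle map sees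
  another reference: the original one together with both memories. Bridging this difference is the
  main obstacle. The remedy is in both cases a factorization \<open>W = L V\<close> with
  \<open>V\<close> a partial isometry: \<open>L\<close> is read as the vector with the small
  reference, and \<open>V\<close> carries that reference to the large one. For the divergence,
  \<open>V\<close> must become part of a genuine channel, since data processing is all that is known
  of \<open>D\<close>; the purifying label is discarded by that same channel, and its action off the
  support of \<open>V\<close> is completed so that the trace is preserved. For the norm, the two
  vectors of a rank-one operator are unrelated, so two partial isometries occur and the resulting
  map need not be a channel.\<close>

lemma decode_pe [simp]: "prod_decode (pe a b) = (a, b)"
  by (simp add: pe_def)

lemma pe_eq_iff [simp]: "pe a b = pe c d \<longleftrightarrow> a = c \<and> b = d"
  by (simp add: pe_def)

lemma pe_exhaust: obtains a b where "m = pe a b"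
  by (metis pe_def prod_decode_inverse surj_pair)

lemma pe_in_tensor [simp]: "pe a b \<in> S \<otimes>\<^sub>s T \<longleftrightarrow> a \<in> S \<and> b \<in> T"
  by (auto simp: sys_tensor_def pe_def)

lemma finite_tensor [simp]: "finite S \<Longrightarrow> finite T \<Longrightarrow> finite (S \<otimes>\<^sub>s T)"
  by (simp add: sys_tensor_def)

lemma sum_tensor: "sum f (S \<otimes>\<^sub>s T) = (\<Sum>s\<in>S. \<Sum>t\<in>T. f (pe s t))"
proof -
  have "inj_on (\<lambda>(i, j). prod_encode (i, j)) (S \<times> T)"
    by (auto simp: inj_on_def)
  then have "sum f (S \<otimes>\<^sub>s T) = (\<Sum>(i, j)\<in>S \<times> T. f (pe i j))"
    unfolding sys_tensor_def by (simp add: sum.reindex pe_def case_prod_beta)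
  then show ?thesis by (simp add: sum.cartesian_product)
qed

text \<open>Every natural number encodes a pair, so agreement on pair labels is agreement
  everywhere. Identities proved this way often need no assumption on supports.\<close>

lemma op_pe_eqI:
  fixes X Y :: op
  assumes "\<And>a b c d. X (pe a b) (pe c d) = Y (pe a b) (pe c d)"
  shows "X = Y"
proof (intro ext)
  fix m n show "X m n = Y m n"
    by (rule pe_exhaust[of m], rule pe_exhaust[of n]) (simp add: assms)
qed

text \<open>The index type is left open because Gram-Schmidt is also applied to vectors indexed by
  pairs.\<close>

definition nrm2 :: "'a set \<Rightarrow> ('a \<Rightarrow> complex) \<Rightarrow> real" where
  "nrm2 S v = (\<Sum>i\<in>S. (cmod (v i))\<^sup>2)"

definition outer :: "nat set \<Rightarrow> (nat \<Rightarrow> complex) \<Rightarrow> (nat \<Rightarrow> complex) \<Rightarrow> op" where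
  "outer S u v = (\<lambda>i j. if i \<in> S \<and> j \<in> S then u i * cnj (v j) else 0)"

definition qf :: "'a set \<Rightarrow> ('a \<Rightarrow> 'a \<Rightarrow> complex) \<Rightarrow> ('a \<Rightarrow> complex) \<Rightarrow> complex" where
  "qf S X v = (\<Sum>i\<in>S. \<Sum>j\<in>S. cnj (v i) * X i j * v j)"

text \<open>Positivity is separated from the support condition because Schur complements and
  products such as \<open>X U\<close> are formed below without regard to their entries outside
  \<open>S\<close>.\<close>

definition qpos :: "'a set \<Rightarrow> ('a \<Rightarrow> 'a \<Rightarrow> complex) \<Rightarrow> bool" where
  "qpos S X \<longleftrightarrow> (\<forall>v. Im (qf S X v) = 0 \<and> Re (qf S X v) \<ge> 0)"

lemma psd_iff_qpos: "psd S X \<longleftrightarrow> op_on S X \<and> qpos S X"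
  by (simp add: psd_def qpos_def qf_def Let_def)

lemma nrm2_nonneg [simp]: "nrm2 S v \<ge> 0"
  by (simp add: nrm2_def sum_nonneg)

lemma nrm2_complex: "complex_of_real (nrm2 S v) = (\<Sum>i\<in>S. v i * cnj (v i))"
  by (simp only: nrm2_def of_real_sum complex_norm_square)

subsection \<open>Gram-Schmidt and Cholesky factorizations\<close>

text \<open>In matrix form this is \<open>W = L V\<close> with \<open>V\<close> a partial isometry:
  its rows in \<open>N\<close> are orthonormal and the others vanish. Keeping \<open>S\<close> as
  the inner index set, in place of one of the size of the rank, makes \<open>L\<close> a vector on
  two copies of \<open>S\<close>.\<close>

definition coisometric_factorization ::
  "'a set \<Rightarrow> 'b set \<Rightarrow> ('a \<Rightarrow> 'b \<Rightarrow> complex) \<Rightarrow> ('a \<Rightarrow> 'a \<Rightarrow> complex) \<Rightarrow> ('a \<Rightarrow> 'b \<Rightarrow> complex) \<Rightarrow> 'a set \<Rightarrow> bool"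
  where "coisometric_factorization S J W L V N \<longleftrightarrow> N \<subseteq> S
     \<and> (\<forall>s\<in>S. \<forall>j\<in>J. W s j = (\<Sum>k\<in>S. L s k * V k j))
     \<and> (\<forall>s k. k \<notin> N \<longrightarrow> L s k = 0)
     \<and> (\<forall>k l. (\<Sum>j\<in>J. V k j * cnj (V l j)) = (if k = l \<and> k \<in> N then 1 else 0))
     \<and> (\<forall>k j. k \<notin> N \<longrightarrow> V k j = 0)"

lemma coisometric_factorizationD:
  assumes "coisometric_factorization S J W L V N"
  shows "N \<subseteq> S"
    and "s \<in> S \<Longrightarrow> j \<in> J \<Longrightarrow> W s j = (\<Sum>k\<in>S. L s k * V k j)"
    and "k \<notin> N \<Longrightarrow> L s k = 0"
    and "(\<Sum>j\<in>J. V k j * cnj (V l j)) = (if k = l \<and> k \<in> N then 1 else 0)"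
    and "k \<notin> N \<Longrightarrow> V k j = 0"
  using assms by (simp_all add: coisometric_factorization_def)

text \<open>The rows of \<open>W\<close> are added one at a time: the projection onto the earlier
  rows of \<open>V\<close> is subtracted and the rest normalized. At most \<open>card S\<close> rows
  arise, however large \<open>J\<close> is.\<close>

lemma gram_schmidt:
  assumes "finite S" "finite J"
  shows "\<exists>L V N. coisometric_factorization S J W L V N"
  using assms(1)
proof (induction S)
  case empty
  have "coisometric_factorization {} J W (\<lambda>_ _. 0) (\<lambda>_ _. 0) {}"
    by (simp add: coisometric_factorization_def)
  then show ?case by blast
next
  case (insert x S)
  then obtain L V N where F: "coisometric_factorization S J W L V N" by blast
  note N = coisometric_factorizationD(1)[OF F] and W = coisometric_factorizationD(2)[OF F]
    and L0 = coisometric_factorizationD(3)[OF F] and V = coisometric_factorizationD(4)[OF F]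
    and V0 = coisometric_factorizationD(5)[OF F]
  have finN: "finite N" using N insert.hyps(1) finite_subset by blast
  define p where "p k = (\<Sum>j\<in>J. W x j * cnj (V k j))" for k
  define e where "e j = W x j - (\<Sum>k\<in>N. p k * V k j)" for j
  \<comment> \<open>For \<open>l\<close> outside \<open>N\<close> the row \<open>V l\<close> is zero
    and so is \<open>p l\<close>; hence orthogonality holds for every \<open>l\<close>.\<close>
  have eV: "(\<Sum>j\<in>J. e j * cnj (V l j)) = 0" for l
  proof -
    have "(\<Sum>j\<in>J. e j * cnj (V l j)) = p l - (\<Sum>j\<in>J. \<Sum>k\<in>N. p k * (V k j * cnj (V l j)))"
      by (simp add: e_def p_def algebra_simps sum_subtractf sum_distrib_left)
    also have "(\<Sum>j\<in>J. \<Sum>k\<in>N. p k * (V k j * cnj (V l j))) = (\<Sum>k\<in>N. p k * (\<Sum>j\<in>J. V k j * cnj (V l j)))"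
      by (subst sum.swap) (simp add: sum_distrib_left)
    also have "\<dots> = (\<Sum>k\<in>N. if k = l then p k else 0)"
      by (intro sum.cong) (auto simp: V)
    also have "\<dots> = (if l \<in> N then p l else 0)"
      using finN by simp
    also have "\<dots> = p l"
      by (auto simp: p_def V0)
    finally show ?thesis by simp
  qed
  have Ve: "(\<Sum>j\<in>J. V l j * cnj (e j)) = 0" for l
  proof -
    have "(\<Sum>j\<in>J. V l j * cnj (e j)) = cnj (\<Sum>j\<in>J. e j * cnj (V l j))" by (simp add: mult.commute)
    then show ?thesis by (simp add: eV)
  qed
  have sumN: "(\<Sum>k\<in>N. f k) = (\<Sum>k\<in>S. if k \<in> N then f k else 0)" for f :: "'a \<Rightarrow> complex"
    using N insert.hyps(1) by (simp add: sum.If_cases Int_absorb1)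
  \<comment> \<open>The length of the residual. If it is zero, \<open>x\<close> stays outside
    \<open>N\<close> and gets a zero row; otherwise the normalized residual becomes the new
    row.\<close>
  define c where "c = sqrt (nrm2 J e)"
  define N' where "N' = (if c = 0 then N else insert x N)"
  define V' where "V' k j = (if k = x then (if c = 0 then 0 else e j / of_real c) else V k j)" for k j
  define L' where "L' s k = (if s = x then (if k = x then of_real c else if k \<in> N then p k else 0)
     else if k = x then 0 else L s k)" for s k
  have xN: "x \<notin> N" using N insert.hyps by blast
  have ce: "e j = 0" if "c = 0" "j \<in> J" for j
    using that assms(2) by (simp add: c_def nrm2_def sum_nonneg_eq_0_iff)
  have c2: "complex_of_real c * of_real c = (\<Sum>j\<in>J. e j * cnj (e j))"
    unfolding nrm2_complex[symmetric] of_real_mult[symmetric] c_def by simp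
  have 1: "N' \<subseteq> insert x S" using N by (auto simp: N'_def)
  have 2: "W s j = (\<Sum>k\<in>insert x S. L' s k * V' k j)" if s: "s \<in> insert x S" and j: "j \<in> J" for s j
  proof (cases "s = x")
    case True
    have "(\<Sum>k\<in>S. L' x k * V' k j) = (\<Sum>k\<in>S. if k \<in> N then p k * V k j else 0)"
      using insert.hyps by (intro sum.cong) (auto simp: L'_def V'_def)
    also have "\<dots> = W x j - e j" unfolding sumN[symmetric] by (simp add: e_def)
    finally have "(\<Sum>k\<in>S. L' x k * V' k j) = W x j - e j" .
    moreover have "L' x x * V' x j = e j" using ce j by (auto simp: L'_def V'_def)
    ultimately show ?thesis using insert.hyps True by simp
  next
    case False
    have "(\<Sum>k\<in>S. L' s k * V' k j) = (\<Sum>k\<in>S. L s k * V k j)"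
      using insert.hyps False by (intro sum.cong) (auto simp: L'_def V'_def)
    then show ?thesis using insert.hyps False W s j by (simp add: L'_def)
  qed
  have 3: "L' s k = 0" if "k \<notin> N'" for s k
    using that by (auto simp: L'_def N'_def L0 split: if_splits)
  have 4: "(\<Sum>j\<in>J. V' k j * cnj (V' l j)) = (if k = l \<and> k \<in> N' then 1 else 0)" for k l
  proof -
    consider "c = 0" "k = x \<or> l = x" | "k \<noteq> x" "l \<noteq> x" | "c \<noteq> 0" "k = x" "l = x"
      | "c \<noteq> 0" "k = x" "l \<noteq> x" | "c \<noteq> 0" "k \<noteq> x" "l = x" by blast
    then show ?thesis
    proof cases
      case 1 then show ?thesis using xN by (auto simp: V'_def N'_def)
    next
      case 2 then show ?thesis using V by (auto simp: V'_def N'_def)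
    next
      case 3
      then have "(\<Sum>j\<in>J. V' k j * cnj (V' l j)) = (\<Sum>j\<in>J. e j * cnj (e j)) / (of_real c * of_real c)"
        by (simp add: V'_def sum_divide_distrib)
      also have "\<dots> = 1" using 3 by (simp add: c2[symmetric])
      finally show ?thesis using 3 by (simp add: N'_def)
    next
      case 4
      then have "(\<Sum>j\<in>J. V' k j * cnj (V' l j)) = (\<Sum>j\<in>J. e j * cnj (V l j)) / of_real c"
        by (simp add: V'_def sum_divide_distrib)
      then show ?thesis using 4 by (simp add: eV)
    next
      case 5
      then have "(\<Sum>j\<in>J. V' k j * cnj (V' l j)) = (\<Sum>j\<in>J. V k j * cnj (e j)) / of_real c"
        by (simp add: V'_def sum_divide_distrib)
      then show ?thesis using 5 by (simp add: Ve)
    qed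
  qed
  have 5: "V' k j = 0" if "k \<notin> N'" for k j
    using that by (auto simp: V'_def N'_def V0 split: if_splits)
  have "coisometric_factorization (insert x S) J W L' V' N'"
    unfolding coisometric_factorization_def using 1 2 3 4 5 by simp
  then show ?case by blast
qed

text \<open>Pythagoras with zero rows allowed: distinct rows are orthogonal and rows outside
  \<open>N\<close> have norm zero, so only the coefficients in \<open>N\<close> count.\<close>

lemma orthonormal_rows_norm:
  assumes "finite S" and NS: "N \<subseteq> S"
    and V: "\<And>k l. k \<in> S \<Longrightarrow> l \<in> S \<Longrightarrow> (\<Sum>j\<in>J. V k j * cnj (V l j)) = (if k = l \<and> k \<in> N then 1 else 0)"
  shows "nrm2 J (\<lambda>j. \<Sum>k\<in>S. a k * V k j) = nrm2 N a"
proof -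
  have "complex_of_real (nrm2 J (\<lambda>j. \<Sum>k\<in>S. a k * V k j))
     = (\<Sum>j\<in>J. \<Sum>k\<in>S. \<Sum>l\<in>S. a k * cnj (a l) * (V k j * cnj (V l j)))"
    by (simp add: nrm2_complex sum_product mult_ac)
  also have "\<dots> = (\<Sum>k\<in>S. \<Sum>l\<in>S. a k * cnj (a l) * (\<Sum>j\<in>J. V k j * cnj (V l j)))"
    by (subst sum.swap, rule sum.cong[OF refl], subst sum.swap) (simp add: sum_distrib_left)
  also have "\<dots> = (\<Sum>k\<in>S. \<Sum>l\<in>S. if l = k then (if k \<in> N then a k * cnj (a k) else 0) else 0)"
    by (intro sum.cong) (auto simp: V)
  also have "\<dots> = (\<Sum>k\<in>S. if k \<in> N then a k * cnj (a k) else 0)"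
    using assms(1) by simp
  also have "\<dots> = complex_of_real (nrm2 N a)"
    using assms(1) NS by (simp add: nrm2_complex sum.If_cases Int_absorb1)
  finally show ?thesis using of_real_eq_iff by blast
qed

lemma qf_two:
  assumes "finite S" "i \<in> S" "j \<in> S" "i \<noteq> j"
  shows "qf S X (\<lambda>k. if k = i then a else if k = j then b else 0)
    = cnj a * X i i * a + cnj a * X i j * b + cnj b * X j i * a + cnj b * X j j * b"
proof -
  let ?v = "\<lambda>k. if k = i then a else if k = j then b else 0"
  have "qf S X ?v = (\<Sum>k\<in>S. \<Sum>l\<in>{i, j}. cnj (?v k) * X k l * ?v l)"
    unfolding qf_def using assms
    by (intro sum.cong refl sum.mono_neutral_right) auto
  also have "\<dots> = (\<Sum>k\<in>{i, j}. \<Sum>l\<in>{i, j}. cnj (?v k) * X k l * ?v l)"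
    using assms by (intro sum.mono_neutral_right) auto
  also have "\<dots> = cnj a * X i i * a + cnj a * X i j * b + cnj b * X j i * a + cnj b * X j j * b"
    using assms(4) by simp
  finally show ?thesis .
qed

lemma qpos_diag:
  assumes "finite S" "qpos S X" "i \<in> S"
  shows "Im (X i i) = 0" "Re (X i i) \<ge> 0"
proof -
  have "qf S X (\<lambda>k. if k = i then 1 else 0)
      = (\<Sum>k\<in>S. \<Sum>l\<in>S. if l = i then (if k = i then X k l else 0) else 0)"
    unfolding qf_def by (intro sum.cong) auto
  also have "\<dots> = X i i"
    using assms(1,3) by simp
  finally have "qf S X (\<lambda>k. if k = i then 1 else 0) = X i i" .
  then show "Im (X i i) = 0" "Re (X i i) \<ge> 0" using assms(2)[unfolded qpos_def, rule_format, of "\<lambda>k. if k = i then 1 else 0"] by simp_all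
qed

text \<open>Polarization with \<open>e_i + e_j\<close> and \<open>e_i + i e_j\<close>: reality of
  the form at the first vector compares the imaginary parts of two opposite entries, at the second
  their real parts.\<close>

lemma qpos_hermitian:
  assumes "finite S" "qpos S X" "i \<in> S" "j \<in> S"
  shows "X j i = cnj (X i j)"
proof (cases "i = j")
  case True then show ?thesis using qpos_diag(1)[OF assms(1,2,3)] by (simp add: complex_eq_iff)
next
  case False
  have "Im (qf S X (\<lambda>k. if k = i then 1 else if k = j then 1 else 0)) = 0"
       "Im (qf S X (\<lambda>k. if k = i then 1 else if k = j then \<i> else 0)) = 0"
    using assms(2) unfolding qpos_def by metis+
  then show ?thesis
    using qpos_diag(1)[OF assms(1,2,3)] qpos_diag(1)[OF assms(1,2,4)]
    by (simp add: qf_two[OF assms(1,3,4) False] complex_eq_iff)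
qed

text \<open>With the diagonal entry zero, the form is affine in the coordinate at \<open>i\<close>
  once the one at \<open>j\<close> is fixed; a nonzero entry \<open>X i j\<close> would make it
  unbounded below.\<close>

lemma qpos_diag_zero:
  assumes "finite S" "qpos S X" "i \<in> S" "j \<in> S" "X i i = 0"
  shows "X i j = 0"
proof (rule ccontr)
  assume nz: "X i j \<noteq> 0"
  then have ne: "i \<noteq> j" using assms by auto
  \<comment> \<open>With this \<open>t\<close> the real part of the form is
    \<open>- Re (X j j) - 2\<close> at the vector with entry \<open>- t * X i j\<close> at
    \<open>i\<close> and 1 at \<open>j\<close>.\<close>
  define t where "t = (Re (X j j) + 1) / (cmod (X i j))\<^sup>2"
  have h: "X j i = cnj (X i j)" using qpos_hermitian[OF assms(1-4)] .
  define q where "q = qf S X (\<lambda>k. if k = i then - of_real t * X i j else if k = j then 1 else 0)"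
  have "q = - of_real t * (X i j * cnj (X i j)) + - of_real t * (X i j * cnj (X i j)) + X j j"
    by (simp add: q_def qf_two[OF assms(1,3,4) ne] assms(5) h)
  then have "Re q = - 2 * (t * (cmod (X i j))\<^sup>2) + Re (X j j)"
    by (simp only: complex_norm_square[symmetric] of_real_mult[symmetric] of_real_minus[symmetric]) simp
  also have "t * (cmod (X i j))\<^sup>2 = Re (X j j) + 1" using nz by (simp add: t_def)
  finally have "Re q < 0" using qpos_diag(2)[OF assms(1,2,4)] by simp
  moreover have "Re q \<ge> 0" using assms(2) by (simp add: q_def qpos_def)
  ultimately show False by simp
qed

text \<open>Induction by Schur complements: eliminating the pivot \<open>x\<close> leaves a positive
  form on the remaining indices.\<close>

lemma cholesky:
  assumes "finite S" "qpos S X"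
  shows "\<exists>L. \<forall>i\<in>S. \<forall>j\<in>S. X i j = (\<Sum>k\<in>S. L i k * cnj (L j k))"
  using assms
proof (induction S arbitrary: X)
  case empty then show ?case by simp
next
  case (insert x S)
  have fin: "finite (insert x S)" using insert by simp
  have herm: "X j i = cnj (X i j)" if "i \<in> insert x S" "j \<in> insert x S" for i j
    using qpos_hermitian[OF fin insert.prems that] .
  define d where "d = Re (X x x)"
  have dx: "X x x = of_real d"
    using qpos_diag(1)[OF fin insert.prems, of x] by (simp add: d_def complex_eq_iff)
  have d0: "d \<ge> 0" using qpos_diag(2)[OF fin insert.prems, of x] by (simp add: d_def)
  \<comment> \<open>The Schur complement of the pivot. For \<open>d = 0\<close> the quotient is 0 by
    convention, so \<open>X'\<close> is \<open>X\<close>; this is right because the row and column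
    of \<open>x\<close> then vanish.\<close>
  define X' where "X' i j = X i j - X i x * X x j / of_real d" for i j
  have zero: "X x j = 0" "X j x = 0" if "d = 0" "j \<in> insert x S" for j
    using qpos_diag_zero[OF fin insert.prems, of x j] that dx herm[of x j] by auto
  have "qpos S X'"
    unfolding qpos_def
  proof
    fix v
    define b where "b = (\<Sum>j\<in>S. X x j * v j)"
    define a where "a = (\<Sum>i\<in>S. cnj (v i) * X i x)"
    \<comment> \<open>With this coordinate at \<open>x\<close> the row of \<open>x\<close>
      contributes nothing, and the form of \<open>X\<close> at \<open>w\<close> becomes that of
      \<open>X'\<close> at \<open>v\<close>.\<close>
    define y where "y = - b / of_real d"
    define w where "w = v(x := y)"
    have wx: "w x = y" by (simp add: w_def)
    have wS: "w i = v i" if "i \<in> S" for i using that insert.hyps by (auto simp: w_def)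
    have e1: "(\<Sum>j\<in>S. X i j * w j) = (\<Sum>j\<in>S. X i j * v j)" for i
      by (intro sum.cong) (auto simp: wS)
    have "qf (insert x S) X w = cnj y * (of_real d * y + b) + (\<Sum>i\<in>S. cnj (w i) * (X i x * y + (\<Sum>j\<in>S. X i j * w j)))"
      using insert.hyps
      by (simp add: qf_def mult.assoc sum_distrib_left[symmetric] distrib_left[symmetric] e1 b_def wx dx)
    also have "(\<Sum>i\<in>S. cnj (w i) * (X i x * y + (\<Sum>j\<in>S. X i j * w j))) = a * y + qf S X v"
      by (simp add: e1 wS qf_def a_def distrib_left sum.distrib sum_distrib_right sum_distrib_left mult.assoc)
    also have "cnj y * (of_real d * y + b) = 0"
      using zero(1) by (cases "d = 0") (auto simp: y_def b_def)
    also have "0 + (a * y + qf S X v) = qf S X v - a * b / of_real d" by (simp add: y_def)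
    also have "\<dots> = qf S X' v"
      by (simp add: qf_def X'_def a_def b_def right_diff_distrib left_diff_distrib sum_subtractf
          sum_product sum_divide_distrib mult.assoc)
    finally have "qf S X' v = qf (insert x S) X w" by simp
    then show "Im (qf S X' v) = 0 \<and> Re (qf S X' v) \<ge> 0"
      using insert.prems unfolding qpos_def by simp
  qed
  from insert.IH[OF this] obtain L where
    L: "\<forall>i\<in>S. \<forall>j\<in>S. X' i j = (\<Sum>k\<in>S. L i k * cnj (L j k))" ..
  \<comment> \<open>The column of \<open>x\<close> restores what the Schur complement removed; for
    \<open>d = 0\<close> it is zero.\<close>
  define M where "M i k = (if k = x then X i x / of_real (sqrt d) else if i = x then 0 else L i k)" for i k
  have sq: "complex_of_real (sqrt d) * of_real (sqrt d) = of_real d"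
    using d0 by (simp flip: of_real_mult)
  have first: "M i x * cnj (M j x) = X i x * X x j / of_real d" if "i \<in> insert x S" "j \<in> insert x S" for i j
    using herm[of j x] that sq by (simp add: M_def)
  have "X i j = (\<Sum>k\<in>insert x S. M i k * cnj (M j k))" if ij: "i \<in> insert x S" "j \<in> insert x S" for i j
  proof (cases "i = x \<or> j = x")
    case True
    then have "(\<Sum>k\<in>S. M i k * cnj (M j k)) = 0"
      using insert.hyps by (intro sum.neutral) (auto simp: M_def)
    moreover have "X i x * X x j / of_real d = X i j"
      using True dx zero ij by (cases "d = 0") auto
    ultimately show ?thesis using insert.hyps first[OF ij] by simp
  next
    case False
    then have "(\<Sum>k\<in>S. M i k * cnj (M j k)) = (\<Sum>k\<in>S. L i k * cnj (L j k))"
      using insert.hyps by (intro sum.cong) (auto simp: M_def)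
    moreover have "i \<in> S" "j \<in> S" using False ij by auto
    ultimately have "(\<Sum>k\<in>S. M i k * cnj (M j k)) = X' i j" using L by simp
    then show ?thesis using insert.hyps first[OF ij] by (simp add: X'_def)
  qed
  then show ?case by blast
qed

subsection \<open>The trace norm\<close>

lemma trace_matmul: "trace S (matmul S U X) = (\<Sum>i\<in>S. \<Sum>k\<in>S. U i k * X k i)"
  by (simp add: trace_def matmul_def)

lemma unitary_rows:
  assumes "unitary S U"
  shows "(\<Sum>k\<in>S. U i k * cnj (U j k)) = (if i = j \<and> i \<in> S then 1 else 0)"
proof -
  have "matmul S U (adj U) i j = idop S i j" using assms by (simp add: unitary_def)
  then show ?thesis by (simp add: matmul_def adj_def idop_def)
qed

lemma unitaryI:
  assumes "op_on S U"
    and "\<And>i j. i \<in> S \<Longrightarrow> j \<in> S \<Longrightarrow> (\<Sum>k\<in>S. U i k * cnj (U j k)) = (if i = j then 1 else 0)"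
  shows "unitary S U"
proof -
  have "matmul S U (adj U) i j = idop S i j" for i j
    using assms by (cases "i \<in> S \<and> j \<in> S") (auto simp: matmul_def adj_def idop_def op_on_def)
  then show ?thesis using assms(1) by (simp add: unitary_def fun_eq_iff)
qed

lemma unitary_idop: "finite S \<Longrightarrow> unitary S (idop S)"
proof (rule unitaryI)
  show "op_on S (idop S)" by (simp add: op_on_def idop_def)
next
  fix i j assume "finite S" and ij: "i \<in> S" "j \<in> S"
  have "(\<Sum>k\<in>S. idop S i k * cnj (idop S j k)) = (\<Sum>k\<in>S. if k = i then (if i = j then 1 else 0) else 0)"
    by (intro sum.cong) (auto simp: idop_def)
  then show "(\<Sum>k\<in>S. idop S i k * cnj (idop S j k)) = (if i = j then 1 else 0)"
    using \<open>finite S\<close> ij by simp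
qed

lemma unitary_entry_le:
  assumes "finite S" "unitary S U"
  shows "cmod (U i k) \<le> 1"
proof (cases "i \<in> S \<and> k \<in> S")
  case True
  have "complex_of_real (nrm2 S (U i)) = 1"
    using True by (simp add: nrm2_complex unitary_rows[OF assms(2)])
  then have "nrm2 S (U i) = 1" by simp
  moreover have "(cmod (U i k))\<^sup>2 \<le> nrm2 S (U i)"
    unfolding nrm2_def using True assms(1) by (intro member_le_sum) auto
  ultimately show ?thesis by (simp add: power_le_one_iff abs_square_le_1[symmetric])
next
  case False
  then show ?thesis using assms(2) by (auto simp: unitary_def op_on_def)
qed

lemma nrm2_diff:
  "complex_of_real (nrm2 S (\<lambda>k. a k - b k)) = of_real (nrm2 S a) + of_real (nrm2 S b)
     - (\<Sum>k\<in>S. a k * cnj (b k)) - cnj (\<Sum>k\<in>S. a k * cnj (b k))"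
proof -
  have "(a k - b k) * cnj (a k - b k)
    = a k * cnj (a k) + b k * cnj (b k) - a k * cnj (b k) - b k * cnj (a k)" for k
    by (simp add: algebra_simps)
  then show ?thesis by (simp add: nrm2_complex sum.distrib sum_subtractf mult.commute)
qed

text \<open>The definition of \<open>unitary\<close> provides orthonormal rows only, so the proof is
  that of Bessel's inequality: for \<open>y\<close> the image of \<open>a\<close> and
  \<open>z\<close> the image of \<open>y\<close> under the adjoint, the squared norm of
  \<open>a - z\<close> is that of \<open>a\<close> minus that of \<open>y\<close>.\<close>

lemma unitary_norm_le:
  assumes "finite S" "unitary S U"
  shows "nrm2 S (\<lambda>i. \<Sum>k\<in>S. U i k * a k) \<le> nrm2 S a"
proof -
  define y where "y i = (\<Sum>k\<in>S. U i k * a k)" for i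
  define z where "z k = (\<Sum>i\<in>S. y i * cnj (U i k))" for k
  have "nrm2 S z = nrm2 S y"
    unfolding z_def
  proof (rule orthonormal_rows_norm[OF assms(1) subset_refl])
    fix k l assume "k \<in> S" "l \<in> S"
    then show "(\<Sum>j\<in>S. cnj (U k j) * cnj (cnj (U l j))) = (if k = l \<and> k \<in> S then 1 else 0)"
      using unitary_rows[OF assms(2), of l k] by (simp add: mult.commute)
  qed
  moreover have "(\<Sum>k\<in>S. a k * cnj (z k)) = of_real (nrm2 S y)"
  proof -
    have "(\<Sum>k\<in>S. a k * cnj (z k)) = (\<Sum>k\<in>S. \<Sum>i\<in>S. U i k * a k * cnj (y i))"
      by (simp add: z_def sum_distrib_left mult_ac)
    also have "\<dots> = (\<Sum>i\<in>S. y i * cnj (y i))"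
      by (subst sum.swap) (simp add: y_def sum_distrib_right)
    finally show ?thesis by (simp add: nrm2_complex)
  qed
  ultimately have "complex_of_real (nrm2 S (\<lambda>k. a k - z k)) = of_real (nrm2 S a - nrm2 S y)"
    by (simp add: nrm2_diff)
  then have "nrm2 S (\<lambda>k. a k - z k) = nrm2 S a - nrm2 S y" using of_real_eq_iff by blast
  then have "nrm2 S y \<le> nrm2 S a" using nrm2_nonneg[of S "\<lambda>k. a k - z k"] by linarith
  then show ?thesis by (simp add: y_def[abs_def])
qed

text \<open>A crude bound independent of \<open>U\<close>. It shows that the real supremum in
  \<open>trace_norm\<close> is taken over a bounded set, so that each unitary gives a lower bound
  for it.\<close>

lemma trace_unitary_le_entries:
  assumes "finite S" "unitary S U"
  shows "cmod (trace S (matmul S U X)) \<le> (\<Sum>i\<in>S. \<Sum>k\<in>S. cmod (X k i))"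
  unfolding trace_matmul
proof (intro sum_norm_le order_trans[OF norm_sum] sum_mono)
  fix i k
  show "cmod (U i k * X k i) \<le> cmod (X k i)"
    using unitary_entry_le[OF assms, of i k] by (simp add: norm_mult mult_left_le_one_le)
qed

lemma trace_norm_upper:
  assumes "finite S" "unitary S U"
  shows "cmod (trace S (matmul S U X)) \<le> trace_norm S X"
proof -
  have "bdd_above ((\<lambda>U. cmod (trace S (matmul S U X))) ` {U. unitary S U})"
    by (rule bdd_aboveI2[of _ _ "\<Sum>i\<in>S. \<Sum>k\<in>S. cmod (X k i)"])
       (simp add: trace_unitary_le_entries[OF assms(1)])
  then show ?thesis unfolding trace_norm_def using assms(2) by (intro cSUP_upper) auto
qed

lemma trace_norm_least:
  assumes "finite S" "\<And>U. unitary S U \<Longrightarrow> cmod (trace S (matmul S U X)) \<le> c"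
  shows "trace_norm S X \<le> c"
  unfolding trace_norm_def
proof (rule cSUP_least)
  show "{U. unitary S U} \<noteq> {}" using unitary_idop[OF assms(1)] by auto
next
  fix U assume "U \<in> {U. unitary S U}"
  then have "unitary S U" by simp
  then show "cmod (trace S (matmul S U X)) \<le> c" by (rule assms(2))
qed

lemma trace_norm_nonneg: "finite S \<Longrightarrow> 0 \<le> trace_norm S X"
  using order_trans[OF norm_ge_zero trace_norm_upper[OF _ unitary_idop]] .

lemma trace_norm_le_entries:
  assumes "finite S"
  shows "trace_norm S X \<le> (\<Sum>i\<in>S. \<Sum>k\<in>S. cmod (X k i))"
proof (rule trace_norm_least[OF assms])
  fix U assume "unitary S U"
  then show "cmod (trace S (matmul S U X)) \<le> (\<Sum>i\<in>S. \<Sum>k\<in>S. cmod (X k i))"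
    by (rule trace_unitary_le_entries[OF assms])
qed

lemma trace_norm_sum_le:
  assumes "finite S"
  shows "trace_norm S (\<lambda>i j. \<Sum>k\<in>I. Z k i j) \<le> (\<Sum>k\<in>I. trace_norm S (Z k))"
proof (rule trace_norm_least[OF assms])
  fix U assume U: "unitary S U"
  have "trace S (matmul S U (\<lambda>i j. \<Sum>k\<in>I. Z k i j)) = (\<Sum>i\<in>S. \<Sum>l\<in>S. \<Sum>k\<in>I. U i l * Z k l i)"
    by (simp add: trace_matmul sum_distrib_left)
  also have "\<dots> = (\<Sum>k\<in>I. trace S (matmul S U (Z k)))"
    by (simp add: trace_matmul sum.swap[of _ S I])
  finally show "cmod (trace S (matmul S U (\<lambda>i j. \<Sum>k\<in>I. Z k i j))) \<le> (\<Sum>k\<in>I. trace_norm S (Z k))"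
    by (simp add: sum_norm_le trace_norm_upper[OF assms U])
qed

lemma trace_norm_scale_le:
  assumes "finite S"
  shows "trace_norm S (\<lambda>i j. c * Z i j) \<le> cmod c * trace_norm S Z"
proof (rule trace_norm_least[OF assms])
  fix U assume U: "unitary S U"
  have "trace S (matmul S U (\<lambda>i j. c * Z i j)) = c * trace S (matmul S U Z)"
    by (simp add: trace_matmul sum_distrib_left mult_ac)
  then show "cmod (trace S (matmul S U (\<lambda>i j. c * Z i j))) \<le> cmod c * trace_norm S Z"
    using trace_norm_upper[OF assms U, of Z] by (simp add: norm_mult mult_left_mono)
qed

text \<open>The mean of the squared norms, unlike the product of the norms, adds up over a
  decomposition without a Cauchy-Schwarz inequality. It comes from bounding \<open>2 a b\<close> by
  \<open>a^2 + b^2\<close> in each coordinate.\<close>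

lemma trace_norm_outer_le:
  assumes "finite S"
  shows "trace_norm S (outer S u v) \<le> (nrm2 S u + nrm2 S v) / 2"
proof (rule trace_norm_least[OF assms])
  fix U assume U: "unitary S U"
  define y where "y i = (\<Sum>k\<in>S. U i k * u k)" for i
  have "trace S (matmul S U (outer S u v)) = (\<Sum>i\<in>S. y i * cnj (v i))"
    by (simp add: trace_matmul outer_def y_def sum_distrib_right mult.assoc)
  also have "cmod \<dots> \<le> (\<Sum>i\<in>S. ((cmod (y i))\<^sup>2 + (cmod (v i))\<^sup>2) / 2)"
  proof (rule sum_norm_le)
    fix i
    show "cmod (y i * cnj (v i)) \<le> ((cmod (y i))\<^sup>2 + (cmod (v i))\<^sup>2) / 2"
      using sum_squares_bound[of "cmod (y i)" "cmod (v i)"] by (simp add: norm_mult)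
  qed
  also have "\<dots> = (nrm2 S y + nrm2 S v) / 2"
    by (simp add: nrm2_def sum_divide_distrib[symmetric] sum.distrib)
  also have "\<dots> \<le> (nrm2 S u + nrm2 S v) / 2"
    using unitary_norm_le[OF assms U, of u] by (simp add: y_def[abs_def])
  finally show "cmod (trace S (matmul S U (outer S u v))) \<le> (nrm2 S u + nrm2 S v) / 2" .
qed

lemma continuous_on_entry: "continuous_on UNIV (\<lambda>U::op. U i j)"
proof -
  have "continuous_on UNIV (\<lambda>U::op. U i)"
    by (rule continuous_on_product_coordinates)
  then show ?thesis by (rule continuous_on_product_then_coordinatewise)
qed

text \<open>Operators are functions on all labels, so the ambient compact set is a product of closed
  unit discs (Tychonoff). Unitarity is a closed condition because each of its equations involves
  finitely many entries.\<close>

lemma compact_unitary: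
  assumes "finite S"
  shows "compact {U. unitary S U}"
proof -
  let ?K = "PiE UNIV (\<lambda>i. PiE UNIV (\<lambda>j. cball 0 1)) :: op set"
  have "compactin (product_topology (\<lambda>_. euclidean) UNIV) (PiE UNIV (\<lambda>j::nat. cball (0::complex) 1))"
    unfolding compactin_PiE by simp
  then have "compact (PiE UNIV (\<lambda>j::nat. cball (0::complex) 1))"
    by (simp add: euclidean_product_topology)
  then have "compactin (product_topology (\<lambda>_. euclidean) UNIV) ?K"
    unfolding compactin_PiE by simp
  then have K: "compact ?K"
    by (simp add: euclidean_product_topology)
  have 1: "closed {U::op. i \<notin> S \<or> j \<notin> S \<longrightarrow> U i j = 0}" for i j
    by (cases "i \<notin> S \<or> j \<notin> S") (auto intro!: closed_Collect_eq continuous_on_entry continuous_intros)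
  have 2: "closed {U::op. (\<Sum>k\<in>S. U i k * cnj (U j k)) = idop S i j}" for i j
    by (intro closed_Collect_eq continuous_intros continuous_on_entry)
  have "{U. unitary S U} = {U. \<forall>i j. i \<notin> S \<or> j \<notin> S \<longrightarrow> U i j = 0}
      \<inter> {U. \<forall>i j. (\<Sum>k\<in>S. U i k * cnj (U j k)) = idop S i j}"
    by (auto simp: unitary_def op_on_def matmul_def adj_def fun_eq_iff)
  moreover have "closed \<dots>"
    by (intro closed_Int closed_Collect_all 1 2)
  moreover have "{U. unitary S U} \<subseteq> ?K"
    using unitary_entry_le[OF assms] by auto
  ultimately show ?thesis
    using compact_Int_closed[OF K, of "{U. unitary S U}"] by (simp add: Int_absorb1)
qed

lemma unitary_maximizer:
  assumes "finite S"
  obtains U where "unitary S U"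
    "\<And>V. unitary S V \<Longrightarrow> Re (trace S (matmul S V X)) \<le> Re (trace S (matmul S U X))"
proof -
  have "continuous_on {U. unitary S U} (\<lambda>U. Re (trace S (matmul S U X)))"
    unfolding trace_matmul
    by (rule continuous_on_subset[of UNIV]) (intro continuous_intros continuous_on_entry, simp)
  moreover have "{U. unitary S U} \<noteq> {}" using unitary_idop[OF assms] by auto
  ultimately obtain U where "U \<in> {U. unitary S U}"
    "\<forall>V\<in>{U. unitary S U}. Re (trace S (matmul S V X)) \<le> Re (trace S (matmul S U X))"
    using continuous_attains_sup[OF compact_unitary[OF assms]] by blast
  then show ?thesis using that by blast
qed

text \<open>This is \<open>U\<close> times the unitary that multiplies the line of \<open>v\<close>
  by the phase \<open>z\<close> and fixes its orthogonal complement.\<close>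

lemma unitary_phase_update:
  assumes "finite S" "unitary S U" "cmod z = 1" "nrm2 S v \<noteq> 0"
  shows "unitary S (\<lambda>i j. if i \<in> S \<and> j \<in> S then
    U i j + (z - 1) / of_real (nrm2 S v) * (\<Sum>k\<in>S. U i k * v k) * cnj (v j) else 0)"
proof (rule unitaryI)
  fix i j assume ij: "i \<in> S" "j \<in> S"
  define n where "n = complex_of_real (nrm2 S v)"
  have n: "n \<noteq> 0" "cnj n = n" using assms(4) by (simp_all add: n_def)
  define y where "y i = (\<Sum>k\<in>S. U i k * v k)" for i
  define w where "w = (z - 1) / n"
  have "z * cnj z = 1" using assms(3) by (simp flip: complex_norm_square)
  \<comment> \<open>The terms created by the update carry this common factor, which equals
    \<open>(|z|^2 - 1) / n\<close>.\<close>
  then have zz: "cnj w + w + w * cnj w * n = 0"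
    using n by (simp add: w_def field_simps)
  have "(\<Sum>k\<in>S. (U i k + w * y i * cnj (v k)) * cnj (U j k + w * y j * cnj (v k)))
    = (\<Sum>k\<in>S. U i k * cnj (U j k)) + cnj w * cnj (y j) * (\<Sum>k\<in>S. U i k * v k)
      + w * y i * cnj (\<Sum>k\<in>S. U j k * v k) + w * cnj w * y i * cnj (y j) * (\<Sum>k\<in>S. v k * cnj (v k))"
    by (simp add: algebra_simps sum.distrib sum_distrib_left)
  also have "\<dots> = (\<Sum>k\<in>S. U i k * cnj (U j k)) + y i * cnj (y j) * (cnj w + w + w * cnj w * n)"
    unfolding y_def[symmetric] nrm2_complex[symmetric] n_def[symmetric] by (simp add: algebra_simps)
  also have "\<dots> = (if i = j then 1 else 0)"
    using zz ij by (simp add: unitary_rows[OF assms(2)])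
  finally show "(\<Sum>k\<in>S. (if i \<in> S \<and> k \<in> S then U i k + (z - 1) / of_real (nrm2 S v) * (\<Sum>k\<in>S. U i k * v k) * cnj (v k) else 0)
      * cnj (if j \<in> S \<and> k \<in> S then U j k + (z - 1) / of_real (nrm2 S v) * (\<Sum>k\<in>S. U j k * v k) * cnj (v k) else 0))
      = (if i = j then 1 else 0)"
    using ij by (simp add: n_def[symmetric] w_def[symmetric] y_def[symmetric] cong: sum.cong)
next
  show "op_on S (\<lambda>i j. if i \<in> S \<and> j \<in> S then
    U i j + (z - 1) / of_real (nrm2 S v) * (\<Sum>k\<in>S. U i k * v k) * cnj (v j) else 0)"
    by (simp add: op_on_def)
qed

text \<open>At a maximizer nothing is gained by rotating the phase of a single line. Applied to the
  line of \<open>v\<close>, this forces the value \<open>q\<close> of the form at \<open>v\<close>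
  to satisfy \<open>cmod q \<le> Re q\<close>, so \<open>q\<close> is real and nonnegative.\<close>

lemma polar_decomposition:
  assumes "finite S"
  obtains U where "unitary S U" "qpos S (\<lambda>i j. \<Sum>k\<in>S. X i k * U k j)"
proof -
  obtain U where U: "unitary S U"
    and max: "\<And>V. unitary S V \<Longrightarrow> Re (trace S (matmul S V X)) \<le> Re (trace S (matmul S U X))"
    using unitary_maximizer[OF assms] by blast
  have "Im q = 0 \<and> Re q \<ge> 0" if q_def: "q = qf S (\<lambda>i j. \<Sum>k\<in>S. X i k * U k j) v" for q v
  proof (cases "nrm2 S v = 0 \<or> q = 0")
    case True
    then show ?thesis
    proof
      assume "nrm2 S v = 0"
      then have "\<forall>i\<in>S. v i = 0" using assms by (simp add: nrm2_def sum_nonneg_eq_0_iff)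
      then have "q = 0" by (simp add: q_def qf_def)
      then show ?thesis by simp
    qed simp
  next
    case False
    \<comment> \<open>The phase that turns \<open>q\<close> into its modulus; with it the objective
      changes by the real part of \<open>(cmod q - q) / n\<close>.\<close>
    define z where "z = cnj q / of_real (cmod q)"
    have z: "cmod z = 1" using False by (simp add: z_def norm_divide)
    define n where "n = nrm2 S v"
    have n: "n > 0" using False nrm2_nonneg[of S v] unfolding n_def by linarith
    define w where "w = (z - 1) / of_real n"
    define y where "y i = (\<Sum>k\<in>S. U i k * v k)" for i
    define V where "V = (\<lambda>i j. if i \<in> S \<and> j \<in> S then U i j + w * y i * cnj (v j) else 0)"
    have V: "unitary S V"
      unfolding V_def w_def y_def n_def using unitary_phase_update[OF assms U z, of v] False by blast
    have q: "q = (\<Sum>i\<in>S. \<Sum>k\<in>S. y i * cnj (v k) * X k i)"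
    proof -
      have "q = (\<Sum>k\<in>S. \<Sum>j\<in>S. \<Sum>i\<in>S. cnj (v k) * X k i * U i j * v j)"
        by (simp add: q_def qf_def sum_distrib_left sum_distrib_right mult_ac)
      also have "\<dots> = (\<Sum>k\<in>S. \<Sum>i\<in>S. y i * cnj (v k) * X k i)"
        by (rule sum.cong[OF refl], subst sum.swap)
           (simp add: y_def sum_distrib_left sum_distrib_right mult_ac)
      also have "\<dots> = (\<Sum>i\<in>S. \<Sum>k\<in>S. y i * cnj (v k) * X k i)"
        by (rule sum.swap)
      finally show ?thesis .
    qed
    have "trace S (matmul S V X) = (\<Sum>i\<in>S. \<Sum>k\<in>S. U i k * X k i + w * (y i * cnj (v k) * X k i))"
      unfolding trace_matmul by (intro sum.cong refl) (simp add: V_def algebra_simps)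
    also have "\<dots> = trace S (matmul S U X) + w * q"
      by (simp add: trace_matmul q sum.distrib sum_distrib_left)
    finally have "Re (w * q) \<le> 0" using max[OF V] by simp
    moreover have "w * q = (of_real (cmod q) - q) / of_real n"
    proof -
      have "z * q = of_real (cmod q)"
        using False complex_norm_square[of q] by (simp add: z_def power2_eq_square mult.commute field_simps)
      then show ?thesis by (simp add: w_def algebra_simps diff_divide_distrib)
    qed
    ultimately have "(cmod q - Re q) / n \<le> 0" by (simp add: Re_divide_of_real)
    then have "cmod q \<le> Re q" using n by (simp add: field_simps)
    then show ?thesis
      using cmod_power2[of q] complex_Re_le_cmod[of q] norm_ge_zero[of q]
      by (smt (verit, best) power2_less_eq_zero_iff)
  qed
  then have "qpos S (\<lambda>i j. \<Sum>k\<in>S. X i k * U k j)" by (simp add: qpos_def)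
  then show ?thesis using that U by blast
qed

text \<open>The Gram vectors \<open>u k\<close> of \<open>Y = X U\<close> are the left vectors.
  Multiplying \<open>Y\<close> by the adjoint of \<open>U\<close> on the right recovers
  \<open>X\<close> and turns the right vectors into \<open>v k = U (u k)\<close>. The left squared
  norms sum to the trace of \<open>Y\<close>, and \<open>U\<close> lengthens no vector.\<close>

lemma trace_norm_decomposition:
  assumes "finite S" "op_on S X"
  obtains u v where "X = (\<lambda>i j. \<Sum>k\<in>S. outer S (u k) (v k) i j)"
    "(\<Sum>k\<in>S. nrm2 S (u k)) \<le> trace_norm S X" "(\<Sum>k\<in>S. nrm2 S (v k)) \<le> trace_norm S X"
proof -
  obtain U where U: "unitary S U" and pos: "qpos S (\<lambda>i j. \<Sum>k\<in>S. X i k * U k j)"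
    using polar_decomposition[OF assms(1)] by blast
  define Y where "Y i j = (\<Sum>k\<in>S. X i k * U k j)" for i j
  obtain L where L: "\<forall>i\<in>S. \<forall>j\<in>S. Y i j = (\<Sum>k\<in>S. L i k * cnj (L j k))"
    using cholesky[OF assms(1) pos] unfolding Y_def by blast
  define u where "u k = (\<lambda>i. L i k)" for k
  define v where "v k = (\<lambda>i. \<Sum>m\<in>S. U i m * u k m)" for k
  have "complex_of_real (\<Sum>k\<in>S. nrm2 S (u k)) = (\<Sum>i\<in>S. Y i i)"
  proof -
    have "complex_of_real (\<Sum>k\<in>S. nrm2 S (u k)) = (\<Sum>k\<in>S. \<Sum>i\<in>S. L i k * cnj (L i k))"
      by (simp add: nrm2_complex u_def)
    also have "\<dots> = (\<Sum>i\<in>S. Y i i)" using L by (subst sum.swap) simp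
    finally show ?thesis .
  qed
  also have "\<dots> = trace S (matmul S U X)"
    unfolding trace_matmul Y_def by (subst sum.swap) (simp add: mult.commute)
  finally have "(\<Sum>k\<in>S. nrm2 S (u k)) = Re (trace S (matmul S U X))"
    by (metis Re_complex_of_real)
  also have "\<dots> \<le> trace_norm S X"
    using order_trans[OF complex_Re_le_cmod trace_norm_upper[OF assms(1) U]] .
  finally have 2: "(\<Sum>k\<in>S. nrm2 S (u k)) \<le> trace_norm S X" .
  have "(\<Sum>k\<in>S. nrm2 S (v k)) \<le> (\<Sum>k\<in>S. nrm2 S (u k))"
    unfolding v_def by (intro sum_mono unitary_norm_le[OF assms(1) U])
  with 2 have 3: "(\<Sum>k\<in>S. nrm2 S (v k)) \<le> trace_norm S X" by simp
  have "X i j = (\<Sum>k\<in>S. outer S (u k) (v k) i j)" for i j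
  proof (cases "i \<in> S \<and> j \<in> S")
    case True
    have "(\<Sum>k\<in>S. outer S (u k) (v k) i j) = (\<Sum>k\<in>S. \<Sum>m\<in>S. L i k * cnj (L m k) * cnj (U j m))"
      using True by (simp add: outer_def u_def v_def sum_distrib_left mult_ac)
    also have "\<dots> = (\<Sum>m\<in>S. Y i m * cnj (U j m))"
      using True L by (subst sum.swap) (simp add: sum_distrib_right)
    also have "\<dots> = (\<Sum>m\<in>S. \<Sum>k\<in>S. X i k * (U k m * cnj (U j m)))"
      by (simp add: Y_def sum_distrib_right mult.assoc)
    also have "\<dots> = (\<Sum>k\<in>S. X i k * (\<Sum>m\<in>S. U k m * cnj (U j m)))"
      by (subst sum.swap) (simp add: sum_distrib_left)
    also have "\<dots> = (\<Sum>k\<in>S. if k = j then X i j else 0)"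
      using True by (intro sum.cong) (auto simp: unitary_rows[OF U])
    also have "\<dots> = X i j" using True assms(1) by simp
    finally show ?thesis by simp
  next
    case False
    then show ?thesis using assms(2) by (auto simp: outer_def op_on_def)
  qed
  then have "X = (\<lambda>i j. \<Sum>k\<in>S. outer S (u k) (v k) i j)" by (intro ext)
  from that[OF this 2 3] show ?thesis .
qed

section \<open>Linear maps, and reduction of norm estimates to rank-one operators\<close>

lemma op_on_outer [simp]: "op_on S (outer S u v)"
  by (simp add: op_on_def outer_def)

lemma op_on_sum: "(\<And>k. k \<in> I \<Longrightarrow> op_on S (Z k)) \<Longrightarrow> op_on S (\<lambda>i j. \<Sum>k\<in>I. Z k i j)"
  by (auto simp: op_on_def intro!: sum.neutral)

lemma is_map_op_on: "is_map S T E \<Longrightarrow> op_on S X \<Longrightarrow> op_on T (E X)"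
  by (simp add: is_map_def)

lemma is_map_add:
  assumes "is_map S T E" "op_on S X" "op_on S Y"
  shows "E (\<lambda>i j. X i j + Y i j) = (\<lambda>i j. E X i j + E Y i j)"
proof -
  from assms(1) have "\<forall>X Y. op_on S X \<longrightarrow> op_on S Y \<longrightarrow>
      E (\<lambda>i j. X i j + Y i j) = (\<lambda>i j. E X i j + E Y i j)"
    unfolding is_map_def by (elim conjE)
  note this[THEN spec, of X]
  note this[THEN spec, of Y]
  then show ?thesis using assms(2,3) by (elim impE)
qed

lemma is_map_scale:
  assumes "is_map S T E" "op_on S X"
  shows "E (\<lambda>i j. c * X i j) = (\<lambda>i j. c * E X i j)"
proof -
  from assms(1) have "\<forall>c X. op_on S X \<longrightarrow> E (\<lambda>i j. c * X i j) = (\<lambda>i j. c * E X i j)"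
    unfolding is_map_def by (elim conjE)
  note this[THEN spec, of c]
  note this[THEN spec, of X]
  then show ?thesis using assms(2) by (elim impE)
qed

lemma is_map_zero:
  assumes "is_map S T E"
  shows "E (\<lambda>i j. 0) = (\<lambda>i j. 0)"
proof -
  have "op_on S (\<lambda>i j. 0)" by (simp add: op_on_def)
  from is_map_scale[OF assms this, of 0] show ?thesis by simp
qed

lemma is_map_sum:
  assumes "is_map S T E" "finite I" "\<And>k. k \<in> I \<Longrightarrow> op_on S (Z k)"
  shows "E (\<lambda>i j. \<Sum>k\<in>I. Z k i j) = (\<lambda>i j. \<Sum>k\<in>I. E (Z k) i j)"
  using assms(2,3)
proof (induction I)
  case empty then show ?case by (simp add: is_map_zero[OF assms(1)])
next
  case (insert x I)
  then have "E (\<lambda>i j. Z x i j + (\<Sum>k\<in>I. Z k i j)) = (\<lambda>i j. E (Z x) i j + E (\<lambda>i j. \<Sum>k\<in>I. Z k i j) i j)"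
    by (intro is_map_add[OF assms(1)] op_on_sum) auto
  then show ?case using insert by simp
qed

lemma is_map_sum_scale:
  assumes "is_map S T E" "finite I" "\<And>k. k \<in> I \<Longrightarrow> op_on S (Z k)"
  shows "E (\<lambda>i j. \<Sum>k\<in>I. c k * Z k i j) = (\<lambda>i j. \<Sum>k\<in>I. c k * E (Z k) i j)"
proof -
  have "E (\<lambda>i j. \<Sum>k\<in>I. c k * Z k i j) = (\<lambda>i j. \<Sum>k\<in>I. E (\<lambda>i j. c k * Z k i j) i j)"
    using assms by (intro is_map_sum) (auto simp: op_on_def)
  then show ?thesis using assms by (simp add: is_map_scale[OF assms(1)] cong: sum.cong)
qed

text \<open>Decomposition, linearity and the triangle inequality reduce contraction to rank-one
  inputs. Relabelings, channels, changes of reference and maps of diamond norm at most one are all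
  treated through this.\<close>

lemma trace_norm_contractive:
  assumes "finite S" "finite T" "is_map S T E" "op_on S X"
    and "\<And>u v. trace_norm T (E (outer S u v)) \<le> (nrm2 S u + nrm2 S v) / 2"
  shows "trace_norm T (E X) \<le> trace_norm S X"
proof -
  obtain u v where X: "X = (\<lambda>i j. \<Sum>k\<in>S. outer S (u k) (v k) i j)"
    and uv: "(\<Sum>k\<in>S. nrm2 S (u k)) \<le> trace_norm S X" "(\<Sum>k\<in>S. nrm2 S (v k)) \<le> trace_norm S X"
    using trace_norm_decomposition[OF assms(1,4)] by blast
  have "E X = (\<lambda>i j. \<Sum>k\<in>S. E (outer S (u k) (v k)) i j)"
    unfolding X by (intro is_map_sum[OF assms(3,1)]) simp
  then have "trace_norm T (E X) \<le> (\<Sum>k\<in>S. trace_norm T (E (outer S (u k) (v k))))"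
    using trace_norm_sum_le[OF assms(2)] by simp
  also have "\<dots> \<le> (\<Sum>k\<in>S. (nrm2 S (u k) + nrm2 S (v k)) / 2)"
    by (intro sum_mono assms(5))
  also have "\<dots> = ((\<Sum>k\<in>S. nrm2 S (u k)) + (\<Sum>k\<in>S. nrm2 S (v k))) / 2"
    by (simp add: sum_divide_distrib[symmetric] sum.distrib)
  also have "\<dots> \<le> trace_norm S X" using uv by simp
  finally show ?thesis .
qed

text \<open>Each rank-one term has as its entry a product of two coordinates, bounded by the mean of
  the squared norms. This later controls the coefficients of \<open>X\<close> with respect to matrix
  units.\<close>

lemma entry_le_trace_norm:
  assumes "finite S" "op_on S X"
  shows "cmod (X i j) \<le> trace_norm S X"
proof (cases "i \<in> S \<and> j \<in> S")
  case True
  obtain u v where X: "X = (\<lambda>i j. \<Sum>k\<in>S. outer S (u k) (v k) i j)"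
    and uv: "(\<Sum>k\<in>S. nrm2 S (u k)) \<le> trace_norm S X" "(\<Sum>k\<in>S. nrm2 S (v k)) \<le> trace_norm S X"
    using trace_norm_decomposition[OF assms] by blast
  have le: "(cmod (a i))\<^sup>2 \<le> nrm2 S a" if "i \<in> S" for i a
    unfolding nrm2_def using assms(1) that by (intro member_le_sum) auto
  have "cmod (X i j) \<le> (\<Sum>k\<in>S. (nrm2 S (u k) + nrm2 S (v k)) / 2)"
    unfolding X
  proof (rule sum_norm_le)
    fix k
    have "2 * (cmod (u k i) * cmod (v k j)) \<le> (cmod (u k i))\<^sup>2 + (cmod (v k j))\<^sup>2"
      using sum_squares_bound[of "cmod (u k i)" "cmod (v k j)"] by simp
    also have "\<dots> \<le> nrm2 S (u k) + nrm2 S (v k)" using True by (intro add_mono le) auto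
    finally show "cmod (outer S (u k) (v k) i j) \<le> (nrm2 S (u k) + nrm2 S (v k)) / 2"
      using True by (simp add: outer_def norm_mult)
  qed
  also have "\<dots> = ((\<Sum>k\<in>S. nrm2 S (u k)) + (\<Sum>k\<in>S. nrm2 S (v k))) / 2"
    by (simp add: sum_divide_distrib[symmetric] sum.distrib)
  also have "\<dots> \<le> trace_norm S X" using uv by simp
  finally show ?thesis .
next
  case False
  then show ?thesis using assms trace_norm_nonneg[of S X] by (auto simp: op_on_def)
qed

subsection \<open>Reference systems and relabelings\<close>

lemma idt_pe [simp]: "idt R E X (pe r b) (pe r' b') =
    (if r \<in> R \<and> r' \<in> R then E (\<lambda>a a'. X (pe r a) (pe r' a')) b b' else 0)"
  by (simp add: idt_def)

lemma idt_comp: "idt R (E \<circ> F) X = idt R E (idt R F X)"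
  by (rule op_pe_eqI) simp

lemma op_on_tensor_iff:
  "op_on (R \<otimes>\<^sub>s S) X \<longleftrightarrow>
    (\<forall>r a r' a'. r \<notin> R \<or> a \<notin> S \<or> r' \<notin> R \<or> a' \<notin> S \<longrightarrow> X (pe r a) (pe r' a') = 0)"
proof
  assume "op_on (R \<otimes>\<^sub>s S) X"
  then show "\<forall>r a r' a'. r \<notin> R \<or> a \<notin> S \<or> r' \<notin> R \<or> a' \<notin> S \<longrightarrow> X (pe r a) (pe r' a') = 0"
    unfolding op_on_def by simp
next
  assume H: "\<forall>r a r' a'. r \<notin> R \<or> a \<notin> S \<or> r' \<notin> R \<or> a' \<notin> S \<longrightarrow> X (pe r a) (pe r' a') = 0"
  show "op_on (R \<otimes>\<^sub>s S) X"
    unfolding op_on_def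
  proof (intro allI impI)
    fix i j assume ij: "i \<notin> R \<otimes>\<^sub>s S \<or> j \<notin> R \<otimes>\<^sub>s S"
    show "X i j = 0"
    proof (rule pe_exhaust[of i], rule pe_exhaust[of j])
      fix a b c d assume "i = pe a b" "j = pe c d"
      then show "X i j = 0" using ij H by auto
    qed
  qed
qed

lemma op_on_slice:
  assumes "op_on (R \<otimes>\<^sub>s S) X"
  shows "op_on S (\<lambda>a a'. X (pe r a) (pe r' a'))"
  using assms by (simp add: op_on_tensor_iff op_on_def)

lemma is_mapI:
  assumes "\<And>X. op_on S X \<Longrightarrow> op_on T (E X)"
    and "\<And>X Y. op_on S X \<Longrightarrow> op_on S Y \<Longrightarrow> E (\<lambda>i j. X i j + Y i j) = (\<lambda>i j. E X i j + E Y i j)"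
    and "\<And>c X. op_on S X \<Longrightarrow> E (\<lambda>i j. c * X i j) = (\<lambda>i j. c * E X i j)"
  shows "is_map S T E"
  unfolding is_map_def using assms by (intro conjI allI impI)

lemma is_map_idt:
  assumes "is_map S T E"
  shows "is_map (R \<otimes>\<^sub>s S) (R \<otimes>\<^sub>s T) (idt R E)"
proof (rule is_mapI)
  fix X assume X: "op_on (R \<otimes>\<^sub>s S) X"
  have "op_on T (E (\<lambda>a a'. X (pe r a) (pe r' a')))" for r r'
    by (rule is_map_op_on[OF assms op_on_slice[OF X]])
  then show "op_on (R \<otimes>\<^sub>s T) (idt R E X)"
    unfolding op_on_tensor_iff by (auto simp: op_on_def)
next
  fix X Y assume "op_on (R \<otimes>\<^sub>s S) X" "op_on (R \<otimes>\<^sub>s S) Y"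
  note add = is_map_add[OF assms op_on_slice[OF this(1)] op_on_slice[OF this(2)]]
  show "idt R E (\<lambda>i j. X i j + Y i j) = (\<lambda>i j. idt R E X i j + idt R E Y i j)"
    by (rule op_pe_eqI) (simp add: add)
next
  fix c X assume "op_on (R \<otimes>\<^sub>s S) X"
  note scale = is_map_scale[OF assms op_on_slice[OF this]]
  show "idt R E (\<lambda>i j. c * X i j) = (\<lambda>i j. c * idt R E X i j)"
    by (rule op_pe_eqI) (simp add: scale)
qed

section \<open>Permutations of basis labels\<close>

definition reindex :: "(nat \<Rightarrow> nat) \<Rightarrow> op \<Rightarrow> op" where
  "reindex f X = (\<lambda>m n. X (f m) (f n))"

text \<open>\<open>f\<close> sends labels of \<open>S'\<close> to labels of \<open>S\<close>, so
  \<open>reindex f\<close> pulls operators on \<open>S\<close> back to \<open>S'\<close>. The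
  bijection is one of all natural numbers, so that entries outside the systems correspond as
  well.\<close>

definition relabeling :: "(nat \<Rightarrow> nat) \<Rightarrow> (nat \<Rightarrow> nat) \<Rightarrow> nat set \<Rightarrow> nat set \<Rightarrow> bool" where
  "relabeling f g S' S \<longleftrightarrow> (\<forall>i. f i \<in> S \<longleftrightarrow> i \<in> S') \<and> (\<forall>i. g (f i) = i) \<and> (\<forall>i. f (g i) = i)"

lemma relabeling_sym: "relabeling f g S' S \<Longrightarrow> relabeling g f S S'"
  unfolding relabeling_def by metis

lemma relabeling_sum:
  assumes "relabeling f g S' S"
  shows "(\<Sum>i\<in>S'. h (f i)) = (\<Sum>i\<in>S. h i)"
proof (rule sum.reindex_bij_betw)
  show "bij_betw f S' S"
    using assms by (intro bij_betw_byWitness[of _ g]) (auto simp: relabeling_def)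
qed

lemma op_on_reindex: "relabeling f g S' S \<Longrightarrow> op_on S X \<Longrightarrow> op_on S' (reindex f X)"
  by (simp add: op_on_def reindex_def relabeling_def)

lemma is_map_reindex: "relabeling f g S' S \<Longrightarrow> is_map S S' (reindex f)"
  by (rule is_mapI) (simp_all add: op_on_reindex, simp_all add: reindex_def)

lemma trace_reindex: "relabeling f g S' S \<Longrightarrow> trace S' (reindex f X) = trace S X"
  unfolding trace_def reindex_def by (rule relabeling_sum)

lemma nrm2_relabel: "relabeling f g S' S \<Longrightarrow> nrm2 S' (\<lambda>i. u (f i)) = nrm2 S u"
  unfolding nrm2_def by (rule relabeling_sum)

lemma psd_reindex:
  assumes "relabeling f g S' S" "psd S X"
  shows "psd S' (reindex f X)"
proof -
  have "qf S' (reindex f X) v = qf S X (\<lambda>i. v (g i))" for v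
  proof -
    have gf: "g (f i) = i" for i using assms(1) by (simp add: relabeling_def)
    have "qf S X (\<lambda>i. v (g i)) = (\<Sum>i\<in>S'. \<Sum>j\<in>S'. cnj (v (g (f i))) * X (f i) (f j) * v (g (f j)))"
      unfolding qf_def relabeling_sum[OF assms(1), symmetric] ..
    then show ?thesis by (simp add: gf qf_def reindex_def)
  qed
  then show ?thesis
    using assms op_on_reindex[OF assms(1)] by (simp add: psd_iff_qpos qpos_def)
qed

lemma trace_norm_reindex_le:
  assumes "relabeling f g S' S" "finite S" "finite S'" "op_on S X"
  shows "trace_norm S' (reindex f X) \<le> trace_norm S X"
proof (rule trace_norm_contractive[OF assms(2,3) is_map_reindex[OF assms(1)] assms(4)])
  fix u v
  have "reindex f (outer S u v) = outer S' (\<lambda>i. u (f i)) (\<lambda>i. v (f i))"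
    using assms(1) by (simp add: reindex_def outer_def relabeling_def)
  then show "trace_norm S' (reindex f (outer S u v)) \<le> (nrm2 S u + nrm2 S v) / 2"
    using trace_norm_outer_le[OF assms(3), of "\<lambda>i. u (f i)" "\<lambda>i. v (f i)"]
    by (simp add: nrm2_relabel[OF assms(1)])
qed

definition on_system :: "(nat \<Rightarrow> nat) \<Rightarrow> nat \<Rightarrow> nat" where
  "on_system f m = (case prod_decode m of (r, a) \<Rightarrow> pe r (f a))"

lemma on_system_pe [simp]: "on_system f (pe r a) = pe r (f a)"
  by (simp add: on_system_def)

lemma relabeling_pe_iff:
  "relabeling f g S' S \<longleftrightarrow> (\<forall>a b. f (pe a b) \<in> S \<longleftrightarrow> pe a b \<in> S')
    \<and> (\<forall>a b. g (f (pe a b)) = pe a b) \<and> (\<forall>a b. f (g (pe a b)) = pe a b)"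
  unfolding relabeling_def by (metis pe_exhaust)

lemma relabeling_on_system:
  "relabeling f g S' S \<Longrightarrow> relabeling (on_system f) (on_system g) (R \<otimes>\<^sub>s S') (R \<otimes>\<^sub>s S)"
  unfolding relabeling_pe_iff[of "on_system f"] by (simp add: relabeling_def)

lemma channel_reindex:
  assumes "relabeling f g S' S"
  shows "channel S S' (reindex f)"
  unfolding channel_def CP_def TP_def
proof (intro conjI allI impI)
  show "is_map S S' (reindex f)" by (rule is_map_reindex[OF assms])
  show "trace S' (reindex f X) = trace S X" for X by (rule trace_reindex[OF assms])
  fix R X assume X: "psd (R \<otimes>\<^sub>s S) X"
  then have "op_on (R \<otimes>\<^sub>s S) X" by (simp add: psd_iff_qpos)
  then have "idt R (reindex f) X = reindex (on_system f) X"
    by (intro op_pe_eqI) (auto simp: reindex_def op_on_tensor_iff)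
  then show "psd (R \<otimes>\<^sub>s S') (idt R (reindex f) X)"
    using psd_reindex[OF relabeling_on_system[OF assms] X] by simp
qed

definition assoc_right :: "nat \<Rightarrow> nat" where
  "assoc_right m = (case prod_decode m of (q, a) \<Rightarrow> case prod_decode q of (r, s) \<Rightarrow> pe r (pe s a))"

definition assoc_left :: "nat \<Rightarrow> nat" where
  "assoc_left m = (case prod_decode m of (r, q) \<Rightarrow> case prod_decode q of (s, a) \<Rightarrow> pe (pe r s) a)"

lemma assoc_pe [simp]:
  "assoc_right (pe (pe r s) a) = pe r (pe s a)" "assoc_left (pe r (pe s a)) = pe (pe r s) a"
  by (simp_all add: assoc_right_def assoc_left_def)

lemma relabeling_assoc: "relabeling assoc_right assoc_left ((R \<otimes>\<^sub>s R0) \<otimes>\<^sub>s S) (R \<otimes>\<^sub>s R0 \<otimes>\<^sub>s S)"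
  unfolding relabeling_def
proof (intro conjI allI)
  fix m
  obtain q a r s where m: "m = pe q a" "q = pe r s" using pe_exhaust by metis
  then show "assoc_left (assoc_right m) = m" "assoc_right m \<in> R \<otimes>\<^sub>s R0 \<otimes>\<^sub>s S \<longleftrightarrow> m \<in> (R \<otimes>\<^sub>s R0) \<otimes>\<^sub>s S"
    by auto
next
  fix m
  obtain q a r s where m: "m = pe r q" "q = pe s a" using pe_exhaust by metis
  then show "assoc_right (assoc_left m) = m" by simp
qed

lemma op_pe3_eqI:
  fixes X Y :: op
  assumes "\<And>a b c a' b' c'. X (pe a (pe b c)) (pe a' (pe b' c')) = Y (pe a (pe b c)) (pe a' (pe b' c'))"
  shows "X = Y"
proof (rule op_pe_eqI)
  fix a q a' q'
  show "X (pe a q) (pe a' q') = Y (pe a q) (pe a' q')"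
    by (rule pe_exhaust[of q], rule pe_exhaust[of q']) (simp add: assms)
qed

text \<open>Two successive references form one composite reference after reassociation. Complete
  positivity of \<open>idt R0 E\<close> thereby reduces to that of \<open>E\<close>.\<close>

lemma idt_idt:
  "idt R (idt R0 E) X = reindex assoc_left (idt (R \<otimes>\<^sub>s R0) E (reindex assoc_right X))"
  by (rule op_pe3_eqI) (simp add: reindex_def)

subsection \<open>Channels\<close>

lemma CP_is_map: "CP S T E \<Longrightarrow> is_map S T E"
  by (simp add: CP_def)

lemma CP_psd: "CP S T E \<Longrightarrow> finite R \<Longrightarrow> psd (R \<otimes>\<^sub>s S) X \<Longrightarrow> psd (R \<otimes>\<^sub>s T) (idt R E X)"
  by (simp add: CP_def)

lemma is_map_comp:
  assumes E: "is_map S T E" and F: "is_map T Q F"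
  shows "is_map S Q (F \<circ> E)"
  by (rule is_mapI)
     (simp_all add: is_map_op_on[OF F] is_map_op_on[OF E] is_map_add[OF E] is_map_add[OF F]
       is_map_scale[OF E] is_map_scale[OF F])

lemma CP_comp:
  assumes "CP S T E" "CP T Q F"
  shows "CP S Q (F \<circ> E)"
  unfolding CP_def
proof (intro conjI allI impI)
  show "is_map S Q (F \<circ> E)"
    by (rule is_map_comp[OF CP_is_map[OF assms(1)] CP_is_map[OF assms(2)]])
  show "psd (R \<otimes>\<^sub>s Q) (idt R (F \<circ> E) X)" if "finite R" "psd (R \<otimes>\<^sub>s S) X" for R X
    unfolding idt_comp using that by (intro CP_psd[OF assms(2)] CP_psd[OF assms(1)])
qed

lemma CP_idt:
  assumes "CP S T E" "finite R0"
  shows "CP (R0 \<otimes>\<^sub>s S) (R0 \<otimes>\<^sub>s T) (idt R0 E)"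
  unfolding CP_def
proof (intro conjI allI impI)
  show "is_map (R0 \<otimes>\<^sub>s S) (R0 \<otimes>\<^sub>s T) (idt R0 E)"
    by (rule is_map_idt[OF CP_is_map[OF assms(1)]])
  fix R X assume R: "finite R" "psd (R \<otimes>\<^sub>s R0 \<otimes>\<^sub>s S) X"
  then have "psd ((R \<otimes>\<^sub>s R0) \<otimes>\<^sub>s T) (idt (R \<otimes>\<^sub>s R0) E (reindex assoc_right X))"
    using assms by (intro CP_psd[OF assms(1)] psd_reindex[OF relabeling_assoc]) simp_all
  then show "psd (R \<otimes>\<^sub>s R0 \<otimes>\<^sub>s T) (idt R (idt R0 E) X)"
    unfolding idt_idt by (rule psd_reindex[OF relabeling_sym[OF relabeling_assoc]])
qed

lemma TP_idt:
  assumes "TP S T E"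
  shows "TP (R \<otimes>\<^sub>s S) (R \<otimes>\<^sub>s T) (idt R E)"
  unfolding TP_def
proof (intro allI impI)
  fix X assume X: "op_on (R \<otimes>\<^sub>s S) X"
  have "trace T (E (\<lambda>a a'. X (pe r a) (pe r a'))) = trace S (\<lambda>a a'. X (pe r a) (pe r a'))" for r
    using assms op_on_slice[OF X] by (simp add: TP_def)
  then show "trace (R \<otimes>\<^sub>s T) (idt R E X) = trace (R \<otimes>\<^sub>s S) X"
    by (simp add: trace_def sum_tensor)
qed

lemma channel_idt:
  "channel S T E \<Longrightarrow> finite R \<Longrightarrow> channel (R \<otimes>\<^sub>s S) (R \<otimes>\<^sub>s T) (idt R E)"
  by (simp add: channel_def CP_idt TP_idt)

lemma channel_is_map: "channel S T E \<Longrightarrow> is_map S T E"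
  by (simp add: channel_def CP_is_map)

lemma channel_comp:
  assumes "channel S T E" "channel T Q F"
  shows "channel S Q (F \<circ> E)"
  unfolding channel_def
proof
  show "CP S Q (F \<circ> E)" using assms CP_comp[of S T E Q F] by (simp add: channel_def)
  show "TP S Q (F \<circ> E)"
    using assms is_map_op_on[OF channel_is_map[OF assms(1)]] by (simp add: channel_def TP_def)
qed

lemma is_state_idt_channel:
  assumes "channel S T E" "finite R" "is_state (R \<otimes>\<^sub>s S) \<rho>"
  shows "is_state (R \<otimes>\<^sub>s T) (idt R E \<rho>)"
proof -
  have "psd (R \<otimes>\<^sub>s S) \<rho>" "trace (R \<otimes>\<^sub>s S) \<rho> = 1" using assms(3) by (simp_all add: is_state_def)
  moreover from this have "op_on (R \<otimes>\<^sub>s S) \<rho>" by (simp add: psd_iff_qpos)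
  moreover have "CP S T E" "TP (R \<otimes>\<^sub>s S) (R \<otimes>\<^sub>s T) (idt R E)"
    using assms(1) TP_idt by (auto simp: channel_def)
  ultimately show ?thesis
    using assms(2) by (simp add: is_state_def CP_psd TP_def)
qed

lemma psd_outer: "psd S (outer S u u)"
proof -
  have "qf S (outer S u u) v = of_real ((cmod (\<Sum>j\<in>S. cnj (u j) * v j))\<^sup>2)" for v
  proof -
    have "qf S (outer S u u) v = (\<Sum>i\<in>S. \<Sum>j\<in>S. (cnj (v i) * u i) * (cnj (u j) * v j))"
      unfolding qf_def by (intro sum.cong refl) (simp add: outer_def mult.assoc)
    also have "\<dots> = cnj (\<Sum>j\<in>S. cnj (u j) * v j) * (\<Sum>j\<in>S. cnj (u j) * v j)"
      by (simp add: sum_product mult.commute)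
    finally show ?thesis by (simp add: complex_norm_square mult.commute del: of_real_power)
  qed
  then show ?thesis by (simp add: psd_iff_qpos qpos_def)
qed

lemma psd_gram:
  assumes "finite S" "psd S X"
  obtains w where "\<And>i j. i \<in> S \<Longrightarrow> j \<in> S \<Longrightarrow> X i j = (\<Sum>k\<in>S. w k i * cnj (w k j))"
proof -
  have "qpos S X" using assms(2) by (simp add: psd_iff_qpos)
  from cholesky[OF assms(1) this] obtain L
    where "\<forall>i\<in>S. \<forall>j\<in>S. X i j = (\<Sum>k\<in>S. L i k * cnj (L j k))" ..
  then show ?thesis using that[of "\<lambda>k i. L i k"] by simp
qed

text \<open>The off-diagonal block of a positive \<open>2 \<times> 2\<close> block operator is a sum of rank-one
  operators whose total size is controlled by the traces of the diagonal blocks.\<close>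

lemma channel_trace_norm_le:
  assumes "finite S" "finite T" "channel S T E" "op_on S X"
  shows "trace_norm T (E X) \<le> trace_norm S X"
proof (rule trace_norm_contractive[OF assms(1,2) channel_is_map[OF assms(3)] assms(4)])
  fix u v :: "nat \<Rightarrow> complex"
  let ?R = "{0, 1} :: nat set"
  define a where "a r = (if r = 0 then u else v)" for r :: nat
  \<comment> \<open>\<open>W\<close> carries \<open>u\<close> at reference state 0 and
    \<open>v\<close> at 1. The block (0,1) of \<open>Z\<close> is then
    \<open>E (outer S u v)\<close>, and its diagonal blocks are the images of positive
    operators.\<close>
  define W where "W m = (case prod_decode m of (r, s) \<Rightarrow> a r s)" for m
  define Z where "Z = idt ?R E (outer (?R \<otimes>\<^sub>s S) W W)"
  have "psd (?R \<otimes>\<^sub>s T) Z"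
    unfolding Z_def using assms(3) by (intro CP_psd[of S T] psd_outer) (simp_all add: channel_def)
  then obtain w where w: "\<And>i j. i \<in> ?R \<otimes>\<^sub>s T \<Longrightarrow> j \<in> ?R \<otimes>\<^sub>s T \<Longrightarrow> Z i j = (\<Sum>k\<in>?R \<otimes>\<^sub>s T. w k i * cnj (w k j))"
    using psd_gram[of "?R \<otimes>\<^sub>s T" Z] assms(2) by auto
  define K where "K = ?R \<otimes>\<^sub>s T"
  have slice: "(\<lambda>s s'. outer (?R \<otimes>\<^sub>s S) W W (pe r s) (pe r' s')) = outer S (a r) (a r')"
    if "r \<in> ?R" "r' \<in> ?R" for r r'
    using that unfolding outer_def W_def by (intro ext) simp
  have E: "E (outer S (a r) (a r')) b b' = (\<Sum>k\<in>K. w k (pe r b) * cnj (w k (pe r' b')))"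
    if "r \<in> ?R" "r' \<in> ?R" "b \<in> T" "b' \<in> T" for r r' b b'
  proof -
    have "Z (pe r b) (pe r' b') = E (outer S (a r) (a r')) b b'"
      unfolding Z_def idt_pe slice[OF that(1,2)] using that by simp
    then show ?thesis using w[of "pe r b" "pe r' b'"] that by (simp add: K_def)
  qed
  define l where "l r k = (\<lambda>b. w k (pe r b))" for r k
  \<comment> \<open>Trace preservation turns the total size of each half of the Gram vectors into
    the squared norm of \<open>u\<close> or \<open>v\<close>.\<close>
  have nrm: "(\<Sum>k\<in>K. nrm2 T (l r k)) = nrm2 S (a r)" if r: "r \<in> ?R" for r
  proof -
    have "complex_of_real (\<Sum>k\<in>K. nrm2 T (l r k)) = (\<Sum>b\<in>T. \<Sum>k\<in>K. w k (pe r b) * cnj (w k (pe r b)))"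
      by (subst sum.swap) (simp add: nrm2_complex l_def)
    also have "\<dots> = trace T (E (outer S (a r) (a r)))"
      unfolding trace_def using E[OF r r] by simp
    also have "\<dots> = trace S (outer S (a r) (a r))"
      using assms(3) by (simp add: channel_def TP_def)
    also have "\<dots> = complex_of_real (nrm2 S (a r))"
      by (simp add: trace_def outer_def nrm2_complex)
    finally show ?thesis using of_real_eq_iff by blast
  qed
  define F where "F = E (outer S u v)"
  have "op_on T F"
    unfolding F_def by (rule is_map_op_on[OF channel_is_map[OF assms(3)]]) simp
  moreover have "F b b' = (\<Sum>k\<in>K. w k (pe 0 b) * cnj (w k (pe 1 b')))" if "b \<in> T" "b' \<in> T" for b b'
    using E[of 0 1 b b'] that by (simp add: a_def F_def)
  ultimately have "F b b' = (\<Sum>k\<in>K. outer T (l 0 k) (l 1 k) b b')" for b b'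
    by (cases "b \<in> T \<and> b' \<in> T") (auto simp: l_def outer_def op_on_def)
  then have "E (outer S u v) = (\<lambda>b b'. \<Sum>k\<in>K. outer T (l 0 k) (l 1 k) b b')"
    unfolding F_def by (intro ext)
  then have "trace_norm T (E (outer S u v)) \<le> (\<Sum>k\<in>K. trace_norm T (outer T (l 0 k) (l 1 k)))"
    using trace_norm_sum_le[OF assms(2)] by simp
  also have "\<dots> \<le> (\<Sum>k\<in>K. (nrm2 T (l 0 k) + nrm2 T (l 1 k)) / 2)"
    by (intro sum_mono trace_norm_outer_le assms(2))
  also have "\<dots> = ((\<Sum>k\<in>K. nrm2 T (l 0 k)) + (\<Sum>k\<in>K. nrm2 T (l 1 k))) / 2"
    by (simp add: sum_divide_distrib[symmetric] sum.distrib)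
  also have "\<dots> = (nrm2 S u + nrm2 S v) / 2"
    using nrm[of 0] nrm[of 1] by (simp add: a_def)
  finally show "trace_norm T (E (outer S u v)) \<le> (nrm2 S u + nrm2 S v) / 2" .
qed

subsection \<open>The diamond norm\<close>

text \<open>Expansion in matrix units bounds any linear map in finite dimension. Hence the supremum
  in \<open>diamond_norm\<close> is over a bounded set even for maps that are not completely
  positive.\<close>

lemma is_map_trace_norm_bounded:
  assumes "finite S" "finite T" "is_map S T E"
  obtains c where "c \<ge> 0" "\<And>X. op_on S X \<Longrightarrow> trace_norm T (E X) \<le> c * trace_norm S X"
proof -
  define e where "e p = (\<lambda>i j. if (i, j) = p \<and> p \<in> S \<times> S then 1 else (0::complex))" for p :: "nat \<times> nat"
  define c where "c = (\<Sum>p\<in>S \<times> S. trace_norm T (E (e p)))"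
  have "trace_norm T (E X) \<le> c * trace_norm S X" if X: "op_on S X" for X
  proof -
    have "X i j = (\<Sum>p\<in>S \<times> S. X (fst p) (snd p) * e p i j)" for i j
    proof -
      have "(\<Sum>p\<in>S \<times> S. X (fst p) (snd p) * e p i j) = (\<Sum>p\<in>S \<times> S. if p = (i, j) then X i j else 0)"
        by (intro sum.cong) (auto simp: e_def)
      also have "\<dots> = X i j" using assms(1) X by (auto simp: op_on_def)
      finally show ?thesis by simp
    qed
    then have "X = (\<lambda>i j. \<Sum>p\<in>S \<times> S. X (fst p) (snd p) * e p i j)" by (intro ext)
    then have "E X = E (\<lambda>i j. \<Sum>p\<in>S \<times> S. X (fst p) (snd p) * e p i j)" by (rule arg_cong)
    also have "\<dots> = (\<lambda>i j. \<Sum>p\<in>S \<times> S. X (fst p) (snd p) * E (e p) i j)"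
    proof (rule is_map_sum_scale[OF assms(3)])
      show "finite (S \<times> S)" using assms(1) by simp
      show "op_on S (e p)" for p by (auto simp: op_on_def e_def)
    qed
    finally have "trace_norm T (E X) \<le> (\<Sum>p\<in>S \<times> S. trace_norm T (\<lambda>i j. X (fst p) (snd p) * E (e p) i j))"
      using trace_norm_sum_le[OF assms(2)] by simp
    also have "\<dots> \<le> (\<Sum>p\<in>S \<times> S. trace_norm S X * trace_norm T (E (e p)))"
    proof (rule sum_mono)
      fix p
      show "trace_norm T (\<lambda>i j. X (fst p) (snd p) * E (e p) i j) \<le> trace_norm S X * trace_norm T (E (e p))"
        using order_trans[OF trace_norm_scale_le[OF assms(2)]
            mult_right_mono[OF entry_le_trace_norm[OF assms(1) X] trace_norm_nonneg[OF assms(2)]]] .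
    qed
    finally show ?thesis by (simp add: c_def sum_distrib_left mult.commute)
  qed
  moreover have "c \<ge> 0" unfolding c_def by (intro sum_nonneg trace_norm_nonneg assms(2))
  ultimately show ?thesis using that by blast
qed

lemma op_on_zero: "op_on S (\<lambda>i j. 0)"
  by (simp add: op_on_def)

lemma trace_norm_zero: "finite S \<Longrightarrow> trace_norm S (\<lambda>i j. 0) = 0"
  using trace_norm_le_entries[of S "\<lambda>i j. 0"] trace_norm_nonneg[of S "\<lambda>i j. 0"] by simp

lemma diamond_norm_upper:
  assumes "finite S" "finite T" "is_map S T \<Phi>"
    and "op_on (S \<otimes>\<^sub>s S) X" "trace_norm (S \<otimes>\<^sub>s S) X \<le> 1"
  shows "trace_norm (S \<otimes>\<^sub>s T) (idt S \<Phi> X) \<le> diamond_norm S T \<Phi>"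
proof -
  have fin: "finite (S \<otimes>\<^sub>s S)" "finite (S \<otimes>\<^sub>s T)" using assms by simp_all
  obtain c where c: "c \<ge> 0"
    "\<And>X. op_on (S \<otimes>\<^sub>s S) X \<Longrightarrow> trace_norm (S \<otimes>\<^sub>s T) (idt S \<Phi> X) \<le> c * trace_norm (S \<otimes>\<^sub>s S) X"
    using is_map_trace_norm_bounded[OF fin is_map_idt[OF assms(3)]] by metis
  show ?thesis
    unfolding diamond_norm_def
  proof (rule cSUP_upper)
    show "X \<in> {X. op_on (S \<otimes>\<^sub>s S) X \<and> trace_norm (S \<otimes>\<^sub>s S) X \<le> 1}" using assms(4,5) by simp
    show "bdd_above ((\<lambda>X. trace_norm (S \<otimes>\<^sub>s T) (idt S \<Phi> X)) `
        {X. op_on (S \<otimes>\<^sub>s S) X \<and> trace_norm (S \<otimes>\<^sub>s S) X \<le> 1})"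
    proof (rule bdd_aboveI2)
      fix X assume "X \<in> {X. op_on (S \<otimes>\<^sub>s S) X \<and> trace_norm (S \<otimes>\<^sub>s S) X \<le> 1}"
      then show "trace_norm (S \<otimes>\<^sub>s T) (idt S \<Phi> X) \<le> c"
        using c(2)[of X] mult_left_le[OF _ c(1), of "trace_norm (S \<otimes>\<^sub>s S) X"] by simp
    qed
  qed
qed

lemma diamond_norm_least:
  assumes "finite S"
    and "\<And>X. op_on (S \<otimes>\<^sub>s S) X \<Longrightarrow> trace_norm (S \<otimes>\<^sub>s S) X \<le> 1 \<Longrightarrow>
      trace_norm (S \<otimes>\<^sub>s T) (idt S \<Phi> X) \<le> c"
  shows "diamond_norm S T \<Phi> \<le> c"
  unfolding diamond_norm_def
proof (rule cSUP_least)
  have "(\<lambda>i j. 0) \<in> {X. op_on (S \<otimes>\<^sub>s S) X \<and> trace_norm (S \<otimes>\<^sub>s S) X \<le> 1}"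
    using assms(1) by (simp add: op_on_zero trace_norm_zero)
  then show "{X. op_on (S \<otimes>\<^sub>s S) X \<and> trace_norm (S \<otimes>\<^sub>s S) X \<le> 1} \<noteq> {}" by blast
next
  fix X assume "X \<in> {X. op_on (S \<otimes>\<^sub>s S) X \<and> trace_norm (S \<otimes>\<^sub>s S) X \<le> 1}"
  then show "trace_norm (S \<otimes>\<^sub>s T) (idt S \<Phi> X) \<le> c" using assms(2)[of X] by simp
qed

lemma diamond_norm_nonneg:
  assumes "finite S" "finite T" "is_map S T \<Phi>"
  shows "0 \<le> diamond_norm S T \<Phi>"
proof -
  have "trace_norm (S \<otimes>\<^sub>s T) (idt S \<Phi> (\<lambda>i j. 0)) \<le> diamond_norm S T \<Phi>"
    using assms by (intro diamond_norm_upper) (simp_all add: op_on_zero trace_norm_zero)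
  then show ?thesis using trace_norm_nonneg[of "S \<otimes>\<^sub>s T"] assms(1,2) order_trans by fastforce
qed

lemma diamond_norm_bound:
  assumes "finite S" "finite T" "is_map S T \<Phi>" "op_on (S \<otimes>\<^sub>s S) X"
  shows "trace_norm (S \<otimes>\<^sub>s T) (idt S \<Phi> X) \<le> diamond_norm S T \<Phi> * trace_norm (S \<otimes>\<^sub>s S) X"
proof -
  have fin: "finite (S \<otimes>\<^sub>s S)" "finite (S \<otimes>\<^sub>s T)" using assms by simp_all
  define t where "t = trace_norm (S \<otimes>\<^sub>s S) X"
  have t0: "t \<ge> 0" using trace_norm_nonneg[OF fin(1)] by (simp add: t_def)
  show ?thesis
  proof (cases "t = 0")
    \<comment> \<open>\<open>X\<close> cannot be normalized here, but the crude bound already makes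
      the left side at most 0.\<close>
    case True
    obtain c where "trace_norm (S \<otimes>\<^sub>s T) (idt S \<Phi> X) \<le> c * t"
      using is_map_trace_norm_bounded[OF fin is_map_idt[OF assms(3)]] assms(4) unfolding t_def by metis
    then show ?thesis using True by (simp add: t_def[symmetric])
  next
    case False
    define Y where "Y = (\<lambda>i j. complex_of_real (1 / t) * X i j)"
    have Yop: "op_on (S \<otimes>\<^sub>s S) Y" using assms(4) by (simp add: Y_def op_on_def)
    have "trace_norm (S \<otimes>\<^sub>s S) Y \<le> cmod (complex_of_real (1 / t)) * t"
      unfolding Y_def t_def by (rule trace_norm_scale_le[OF fin(1)])
    also have "\<dots> = 1" using False t0 by (simp add: norm_divide)
    finally have Y1: "trace_norm (S \<otimes>\<^sub>s T) (idt S \<Phi> Y) \<le> diamond_norm S T \<Phi>"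
      by (rule diamond_norm_upper[OF assms(1-3) Yop])
    have "X = (\<lambda>i j. complex_of_real t * Y i j)" using False by (simp add: Y_def)
    then have "idt S \<Phi> X = (\<lambda>i j. complex_of_real t * idt S \<Phi> Y i j)"
      using is_map_scale[OF is_map_idt[OF assms(3)] Yop, of "complex_of_real t"] by simp
    then have "trace_norm (S \<otimes>\<^sub>s T) (idt S \<Phi> X) \<le> cmod (complex_of_real t) * trace_norm (S \<otimes>\<^sub>s T) (idt S \<Phi> Y)"
      using trace_norm_scale_le[OF fin(2), of "complex_of_real t" "idt S \<Phi> Y"] by simp
    also have "\<dots> \<le> t * diamond_norm S T \<Phi>" using Y1 t0 by (simp add: mult_left_mono)
    finally show ?thesis by (simp add: t_def mult.commute)
  qed
qed

section \<open>Changing the reference system along a partial isometry\<close>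

definition apply_ref :: "nat set \<Rightarrow> (nat \<Rightarrow> nat \<Rightarrow> complex) \<Rightarrow> (nat \<Rightarrow> complex) \<Rightarrow> nat \<Rightarrow> complex" where
  "apply_ref S V a m = (case prod_decode m of (r, b) \<Rightarrow> \<Sum>k\<in>S. a (pe k b) * V k r)"

text \<open>\<open>apply_ref\<close> is the transpose of \<open>V\<close> tensored with the
  identity. \<open>compress_ref\<close> applies it on the left, and on the right the adjoint of its
  analogue for \<open>W\<close>, taking reference \<open>S\<close> to reference \<open>R\<close>.
  \<open>V\<close> and \<open>W\<close> differ because the two vectors of a rank-one operator have
  unrelated Schmidt decompositions.\<close>

definition compress_ref :: "nat set \<Rightarrow> nat set \<Rightarrow> (nat \<Rightarrow> nat \<Rightarrow> complex) \<Rightarrow> (nat \<Rightarrow> nat \<Rightarrow> complex) \<Rightarrow> op \<Rightarrow> op" where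
  "compress_ref R S V W Z = (\<lambda>m n. case prod_decode m of (r, b) \<Rightarrow> case prod_decode n of (r', b') \<Rightarrow>
     if r \<in> R \<and> r' \<in> R then \<Sum>p\<in>S \<times> S. V (fst p) r * cnj (W (snd p) r') * Z (pe (fst p) b) (pe (snd p) b') else 0)"

lemma compress_ref_pe: "compress_ref R S V W Z (pe r b) (pe r' b') =
    (if r \<in> R \<and> r' \<in> R then \<Sum>p\<in>S \<times> S. V (fst p) r * cnj (W (snd p) r') * Z (pe (fst p) b) (pe (snd p) b') else 0)"
  by (simp add: compress_ref_def)

text \<open>For each basis state of \<open>T\<close>, Pythagoras leaves the coefficients in
  \<open>N\<close>; those outside \<open>N\<close> are lost, whence an inequality.\<close>

lemma apply_ref_norm_le:
  assumes "finite S" "N \<subseteq> S"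
    and "\<And>k l. (\<Sum>j\<in>R. V k j * cnj (V l j)) = (if k = l \<and> k \<in> N then 1 else (0::complex))"
  shows "nrm2 (R \<otimes>\<^sub>s T) (apply_ref S V a) \<le> nrm2 (S \<otimes>\<^sub>s T) a"
proof -
  have "nrm2 (R \<otimes>\<^sub>s T) (apply_ref S V a) = (\<Sum>b\<in>T. nrm2 R (\<lambda>r. \<Sum>k\<in>S. a (pe k b) * V k r))"
    unfolding nrm2_def sum_tensor by (subst sum.swap) (simp add: apply_ref_def)
  also have "\<dots> = (\<Sum>b\<in>T. nrm2 N (\<lambda>k. a (pe k b)))"
    by (intro sum.cong refl orthonormal_rows_norm[OF assms(1,2) assms(3)])
  also have "\<dots> \<le> (\<Sum>b\<in>T. nrm2 S (\<lambda>k. a (pe k b)))"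
    unfolding nrm2_def using assms(1,2) by (intro sum_mono sum_mono2) auto
  also have "\<dots> = nrm2 (S \<otimes>\<^sub>s T) a"
    unfolding nrm2_def sum_tensor by (rule sum.swap)
  finally show ?thesis .
qed

lemma is_map_compress_ref: "is_map (S \<otimes>\<^sub>s T) (R \<otimes>\<^sub>s T) (compress_ref R S V W)"
proof (rule is_mapI)
  fix X assume "op_on (S \<otimes>\<^sub>s T) X"
  then show "op_on (R \<otimes>\<^sub>s T) (compress_ref R S V W X)"
    unfolding op_on_tensor_iff compress_ref_pe by (auto intro!: sum.neutral)
next
  fix X Y :: op
  show "compress_ref R S V W (\<lambda>i j. X i j + Y i j) = (\<lambda>i j. compress_ref R S V W X i j + compress_ref R S V W Y i j)"
    by (rule op_pe_eqI) (simp add: compress_ref_pe distrib_left sum.distrib)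
next
  fix c and X :: op
  show "compress_ref R S V W (\<lambda>i j. c * X i j) = (\<lambda>i j. c * compress_ref R S V W X i j)"
    by (rule op_pe_eqI) (simp add: compress_ref_pe sum_distrib_left mult.left_commute)
qed

lemma compress_ref_outer:
  assumes "finite S"
  shows "compress_ref R S V W (outer (S \<otimes>\<^sub>s T) a b) = outer (R \<otimes>\<^sub>s T) (apply_ref S V a) (apply_ref S W b)"
proof (rule op_pe_eqI)
  fix r t r' t'
  show "compress_ref R S V W (outer (S \<otimes>\<^sub>s T) a b) (pe r t) (pe r' t')
    = outer (R \<otimes>\<^sub>s T) (apply_ref S V a) (apply_ref S W b) (pe r t) (pe r' t')"
  proof (cases "r \<in> R \<and> r' \<in> R \<and> t \<in> T \<and> t' \<in> T")
    case True
    then have "compress_ref R S V W (outer (S \<otimes>\<^sub>s T) a b) (pe r t) (pe r' t')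
      = (\<Sum>p\<in>S \<times> S. a (pe (fst p) t) * V (fst p) r * cnj (b (pe (snd p) t') * W (snd p) r'))"
      unfolding compress_ref_pe by (auto simp: outer_def intro!: sum.cong)
    also have "\<dots> = (\<Sum>k\<in>S. a (pe k t) * V k r) * cnj (\<Sum>k\<in>S. b (pe k t') * W k r')"
      by (simp add: sum.cartesian_product' sum_product)
    finally show ?thesis using True by (simp add: outer_def apply_ref_def)
  next
    case False
    then show ?thesis by (auto simp: compress_ref_pe outer_def intro!: sum.neutral)
  qed
qed

lemma trace_norm_compress_ref_le:
  assumes "finite R" "finite S" "finite T" "op_on (S \<otimes>\<^sub>s T) Z" "N \<subseteq> S" "N' \<subseteq> S"
    and V: "\<And>k l. (\<Sum>j\<in>R. V k j * cnj (V l j)) = (if k = l \<and> k \<in> N then 1 else (0::complex))"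
    and W: "\<And>k l. (\<Sum>j\<in>R. W k j * cnj (W l j)) = (if k = l \<and> k \<in> N' then 1 else (0::complex))"
  shows "trace_norm (R \<otimes>\<^sub>s T) (compress_ref R S V W Z) \<le> trace_norm (S \<otimes>\<^sub>s T) Z"
proof (rule trace_norm_contractive[OF _ _ is_map_compress_ref assms(4)])
  show "finite (S \<otimes>\<^sub>s T)" "finite (R \<otimes>\<^sub>s T)" using assms(1-3) by simp_all
  then show "trace_norm (R \<otimes>\<^sub>s T) (compress_ref R S V W (outer (S \<otimes>\<^sub>s T) u v))
      \<le> (nrm2 (S \<otimes>\<^sub>s T) u + nrm2 (S \<otimes>\<^sub>s T) v) / 2" for u v
    using trace_norm_outer_le[of "R \<otimes>\<^sub>s T" "apply_ref S V u" "apply_ref S W v"]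
      apply_ref_norm_le[OF assms(2,5) V, of T u] apply_ref_norm_le[OF assms(2,6) W, of T v]
    by (simp add: compress_ref_outer[OF assms(2)])
qed

text \<open>\<open>u\<close> is factored as a matrix with one row for each basis state of
  \<open>S\<close>. No norm is lost, because the coefficients \<open>L\<close> vanish outside
  \<open>N\<close>.\<close>

lemma schmidt_compression:
  assumes "finite R" "finite S"
  obtains a V N where "N \<subseteq> S"
    "\<And>k l. (\<Sum>j\<in>R. V k j * cnj (V l j)) = (if k = l \<and> k \<in> N then 1 else (0::complex))"
    "\<And>r s. r \<in> R \<Longrightarrow> s \<in> S \<Longrightarrow> u (pe r s) = apply_ref S V a (pe r s)"
    "nrm2 (S \<otimes>\<^sub>s S) a = nrm2 (R \<otimes>\<^sub>s S) u"
proof -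
  obtain L V N where F: "coisometric_factorization S R (\<lambda>s r. u (pe r s)) L V N"
    using gram_schmidt[OF assms(2,1)] by blast
  note N = coisometric_factorizationD(1)[OF F] and W = coisometric_factorizationD(2)[OF F]
    and L0 = coisometric_factorizationD(3)[OF F] and V = coisometric_factorizationD(4)[OF F]
  define a where "a m = (case prod_decode m of (k, s) \<Rightarrow> L s k)" for m
  have u: "u (pe r s) = apply_ref S V a (pe r s)" if "r \<in> R" "s \<in> S" for r s
    using W that by (simp add: apply_ref_def a_def)
  have "nrm2 (R \<otimes>\<^sub>s S) u = (\<Sum>s\<in>S. nrm2 R (\<lambda>r. \<Sum>k\<in>S. L s k * V k r))"
    unfolding nrm2_def sum_tensor by (subst sum.swap) (simp add: W)
  also have "\<dots> = (\<Sum>s\<in>S. nrm2 N (L s))"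
    by (intro sum.cong refl orthonormal_rows_norm[OF assms(2) N V])
  also have "\<dots> = (\<Sum>s\<in>S. nrm2 S (L s))"
    unfolding nrm2_def using assms(2) N by (intro sum.cong refl sum.mono_neutral_left) (auto simp: L0)
  also have "\<dots> = nrm2 (S \<otimes>\<^sub>s S) a"
    unfolding nrm2_def sum_tensor by (subst sum.swap) (simp add: a_def)
  finally show ?thesis using that[OF N V u] by simp
qed

text \<open>A vector on \<open>R \<otimes> S\<close> has Schmidt rank at most \<open>card S\<close>, so its reference can be compressed to a copy of \<open>S\<close>.\<close>

lemma diamond_norm_stable:
  assumes "finite R" "finite S" "finite T" "is_map S T \<Phi>" "diamond_norm S T \<Phi> \<le> 1"
    and "op_on (R \<otimes>\<^sub>s S) X"
  shows "trace_norm (R \<otimes>\<^sub>s T) (idt R \<Phi> X) \<le> trace_norm (R \<otimes>\<^sub>s S) X"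
proof (rule trace_norm_contractive[OF _ _ is_map_idt[OF assms(4)] assms(6)])
  show "finite (R \<otimes>\<^sub>s S)" "finite (R \<otimes>\<^sub>s T)" using assms(1-3) by simp_all
  fix u v :: "nat \<Rightarrow> complex"
  obtain a V N where V: "N \<subseteq> S"
    "\<And>k l. (\<Sum>j\<in>R. V k j * cnj (V l j)) = (if k = l \<and> k \<in> N then 1 else (0::complex))"
    "\<And>r s. r \<in> R \<Longrightarrow> s \<in> S \<Longrightarrow> u (pe r s) = apply_ref S V a (pe r s)"
    "nrm2 (S \<otimes>\<^sub>s S) a = nrm2 (R \<otimes>\<^sub>s S) u"
    by (rule schmidt_compression[OF assms(1,2), of u], rule that)
  obtain b W N' where W: "N' \<subseteq> S"
    "\<And>k l. (\<Sum>j\<in>R. W k j * cnj (W l j)) = (if k = l \<and> k \<in> N' then 1 else (0::complex))"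
    "\<And>r s. r \<in> R \<Longrightarrow> s \<in> S \<Longrightarrow> v (pe r s) = apply_ref S W b (pe r s)"
    "nrm2 (S \<otimes>\<^sub>s S) b = nrm2 (R \<otimes>\<^sub>s S) v"
    by (rule schmidt_compression[OF assms(1,2), of v], rule that)
  define Y where "Y = outer (S \<otimes>\<^sub>s S) a b"
  have Y: "op_on (S \<otimes>\<^sub>s S) Y" by (simp add: Y_def)
  have "outer (R \<otimes>\<^sub>s S) u v = outer (R \<otimes>\<^sub>s S) (apply_ref S V a) (apply_ref S W b)"
    by (rule op_pe_eqI) (simp add: outer_def V(3) W(3))
  then have XY: "outer (R \<otimes>\<^sub>s S) u v = compress_ref R S V W Y"
    by (simp add: Y_def compress_ref_outer[OF assms(2)])
  \<comment> \<open>An operation on the reference commutes with a map on the system, by linearity of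
    \<open>\<Phi>\<close> over the finite sum in \<open>compress_ref\<close>.\<close>
  have "idt R \<Phi> (compress_ref R S V W Y) = compress_ref R S V W (idt S \<Phi> Y)"
  proof (rule op_pe_eqI)
    fix r t r' t'
    show "idt R \<Phi> (compress_ref R S V W Y) (pe r t) (pe r' t') = compress_ref R S V W (idt S \<Phi> Y) (pe r t) (pe r' t')"
    proof (cases "r \<in> R \<and> r' \<in> R")
      case True
      define c where "c p = V (fst p) r * cnj (W (snd p) r')" for p
      define Z where "Z p = (\<lambda>s s'. Y (pe (fst p) s) (pe (snd p) s'))" for p
      have "\<Phi> (\<lambda>s s'. \<Sum>p\<in>S \<times> S. c p * Z p s s') = (\<lambda>s s'. \<Sum>p\<in>S \<times> S. c p * \<Phi> (Z p) s s')"
        using assms(2) by (intro is_map_sum_scale[OF assms(4)]) (simp_all add: Z_def op_on_slice[OF Y])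
      moreover have "(\<lambda>s s'. compress_ref R S V W Y (pe r s) (pe r' s')) = (\<lambda>s s'. \<Sum>p\<in>S \<times> S. c p * Z p s s')"
        using True by (simp add: compress_ref_pe c_def Z_def)
      ultimately have "idt R \<Phi> (compress_ref R S V W Y) (pe r t) (pe r' t') = (\<Sum>p\<in>S \<times> S. c p * \<Phi> (Z p) t t')"
        using True by (simp only: idt_pe simp_thms if_True)
      also have "\<dots> = (\<Sum>p\<in>S \<times> S. c p * idt S \<Phi> Y (pe (fst p) t) (pe (snd p) t'))"
        by (intro sum.cong refl) (auto simp: Z_def)
      finally show ?thesis using True by (simp add: compress_ref_pe c_def)
    qed (auto simp: compress_ref_pe)
  qed
  then have "trace_norm (R \<otimes>\<^sub>s T) (idt R \<Phi> (outer (R \<otimes>\<^sub>s S) u v))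
      = trace_norm (R \<otimes>\<^sub>s T) (compress_ref R S V W (idt S \<Phi> Y))" by (simp add: XY)
  also have "\<dots> \<le> trace_norm (S \<otimes>\<^sub>s T) (idt S \<Phi> Y)"
    by (rule trace_norm_compress_ref_le[OF assms(1-3) is_map_op_on[OF is_map_idt[OF assms(4)] Y] V(1) W(1) V(2) W(2)])
  also have "\<dots> \<le> diamond_norm S T \<Phi> * trace_norm (S \<otimes>\<^sub>s S) Y"
    by (rule diamond_norm_bound[OF assms(2,3,4) Y])
  also have "\<dots> \<le> trace_norm (S \<otimes>\<^sub>s S) Y"
    using assms(2,5) by (intro mult_left_le_one_le trace_norm_nonneg diamond_norm_nonneg assms) simp_all
  also have "\<dots> \<le> (nrm2 (S \<otimes>\<^sub>s S) a + nrm2 (S \<otimes>\<^sub>s S) b) / 2"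
    unfolding Y_def using assms(2) by (intro trace_norm_outer_le) simp
  finally show "trace_norm (R \<otimes>\<^sub>s T) (idt R \<Phi> (outer (R \<otimes>\<^sub>s S) u v))
      \<le> (nrm2 (R \<otimes>\<^sub>s S) u + nrm2 (R \<otimes>\<^sub>s S) v) / 2"
    by (simp add: V(4) W(4))
qed

subsection \<open>Partial transposes and the superchannel\<close>

lemma ptB_pe [simp]: "ptB X (pe a b) (pe a' b') = X (pe a b') (pe a' b)"
  by (simp add: ptB_def)

lemma ptB_ptB [simp]: "ptB (ptB X) = X"
  by (rule op_pe_eqI) simp

lemma is_map_ptB: "is_map (A \<otimes>\<^sub>s B) (A \<otimes>\<^sub>s B) ptB"
proof (rule is_mapI)
  show "op_on (A \<otimes>\<^sub>s B) (ptB X)" if "op_on (A \<otimes>\<^sub>s B) X" for X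
    using that unfolding op_on_tensor_iff by auto
  show "ptB (\<lambda>i j. X i j + Y i j) = (\<lambda>i j. ptB X i j + ptB Y i j)" for X Y
    by (rule op_pe_eqI) simp
  show "ptB (\<lambda>i j. c * X i j) = (\<lambda>i j. c * ptB X i j)" for c X
    by (rule op_pe_eqI) simp
qed

lemma is_map_ptB_conj:
  assumes "is_map (A' \<otimes>\<^sub>s B') (A \<otimes>\<^sub>s B) E"
  shows "is_map (A' \<otimes>\<^sub>s B') (A \<otimes>\<^sub>s B) (ptB \<circ> E \<circ> ptB)"
  by (rule is_map_comp[OF is_map_ptB is_map_comp[OF assms is_map_ptB]])

lemma trace_ptB: "trace (A \<otimes>\<^sub>s B) (ptB X) = trace (A \<otimes>\<^sub>s B) X"
  by (simp add: trace_def sum_tensor)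

text \<open>Partial transposition preserves the trace, so the conjugated map inherits trace
  preservation from \<open>P\<close>, and its complete positivity is assumed. Being a channel, it
  contracts the trace norm.\<close>

lemma completely_PPT_preserving_channels:
  assumes "completely_PPT_preserving A' B' A B P"
  shows "channel (A' \<otimes>\<^sub>s B') (A \<otimes>\<^sub>s B) P" "channel (A' \<otimes>\<^sub>s B') (A \<otimes>\<^sub>s B) (ptB \<circ> P \<circ> ptB)"
proof -
  show 1: "channel (A' \<otimes>\<^sub>s B') (A \<otimes>\<^sub>s B) P"
    using assms by (simp add: completely_PPT_preserving_def bipartite_channel_def)
  have "TP (A' \<otimes>\<^sub>s B') (A \<otimes>\<^sub>s B) (ptB \<circ> P \<circ> ptB)"
    using 1 is_map_op_on[OF is_map_ptB] by (simp add: channel_def TP_def trace_ptB)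
  then show "channel (A' \<otimes>\<^sub>s B') (A \<otimes>\<^sub>s B) (ptB \<circ> P \<circ> ptB)"
    using assms by (simp add: completely_PPT_preserving_def channel_def)
qed

definition with_memory :: "nat \<Rightarrow> nat \<Rightarrow> nat \<Rightarrow> nat" where
  "with_memory am bm p = (case prod_decode p of (x, y) \<Rightarrow> pe (pe x am) (pe y bm))"

lemma with_memory_pe [simp]: "with_memory am bm (pe x y) = pe (pe x am) (pe y bm)"
  by (simp add: with_memory_def)

lemma lift_mid_pe: "lift_mid AM BM M X (pe (pe a am) (pe b bm)) (pe (pe a' am') (pe b' bm')) =
    (if am \<in> AM \<and> bm \<in> BM \<and> am' \<in> AM \<and> bm' \<in> BM
     then M (\<lambda>p q. X (with_memory am bm p) (with_memory am' bm' q)) (pe a b) (pe a' b') else 0)"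
proof -
  have "(\<lambda>p q. case prod_decode p of (x, y) \<Rightarrow> case prod_decode q of (x', y') \<Rightarrow>
      X (pe (pe x am) (pe y bm)) (pe (pe x' am') (pe y' bm')))
    = (\<lambda>p q. X (with_memory am bm p) (with_memory am' bm' q))"
    by (rule op_pe_eqI) simp
  then show ?thesis by (simp add: lift_mid_def)
qed

lemma pe4_exhaust: obtains a b c d where "m = pe (pe a b) (pe c d)"
  by (metis pe_exhaust)

lemma op_pe4_eqI:
  fixes X Y :: op
  assumes "\<And>a am b bm a' am' b' bm'. X (pe (pe a am) (pe b bm)) (pe (pe a' am') (pe b' bm'))
    = Y (pe (pe a am) (pe b bm)) (pe (pe a' am') (pe b' bm'))"
  shows "X = Y"
proof (intro ext)
  fix m n show "X m n = Y m n"
    by (rule pe4_exhaust[of m], rule pe4_exhaust[of n]) (simp add: assms)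
qed

text \<open>\<open>ptB\<close> on the enlarged system transposes Bob's memory too. Since
  \<open>lift_mid\<close> acts as the identity there, the two transpositions of the memory
  cancel.\<close>

lemma ptB_lift_mid: "ptB (lift_mid AM BM M (ptB X)) = lift_mid AM BM (ptB \<circ> M \<circ> ptB) X"
proof (rule op_pe4_eqI)
  fix a am b bm a' am' b' bm'
  have "(\<lambda>p q. ptB X (with_memory am bm' p) (with_memory am' bm q))
     = ptB (\<lambda>p q. X (with_memory am bm p) (with_memory am' bm' q))"
    by (rule op_pe_eqI) simp
  then show "ptB (lift_mid AM BM M (ptB X)) (pe (pe a am) (pe b bm)) (pe (pe a' am') (pe b' bm'))
    = lift_mid AM BM (ptB \<circ> M \<circ> ptB) X (pe (pe a am) (pe b bm)) (pe (pe a' am') (pe b' bm'))"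
    by (auto simp: lift_mid_pe)
qed

text \<open>Relates the layout with the memories beside Alice's and Bob's systems to the one with
  the memories in the reference. In the latter \<open>lift_mid\<close> is an instance of
  \<open>idt\<close>, so statements about arbitrary references apply.\<close>

definition regroup :: "nat \<Rightarrow> nat" where
  "regroup m = (case prod_decode m of (q, p) \<Rightarrow> case prod_decode q of (r, ab) \<Rightarrow>
     case prod_decode ab of (am, bm) \<Rightarrow> pe r (with_memory am bm p))"

definition ungroup :: "nat \<Rightarrow> nat" where
  "ungroup m = (case prod_decode m of (r, t) \<Rightarrow> case prod_decode t of (\<alpha>, \<beta>) \<Rightarrow>
     case prod_decode \<alpha> of (x, am) \<Rightarrow> case prod_decode \<beta> of (y, bm) \<Rightarrow>
     pe (pe r (pe am bm)) (pe x y))"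

lemma regroup_pe [simp]: "regroup (pe (pe r (pe am bm)) p) = pe r (with_memory am bm p)"
  by (simp add: regroup_def)

lemma ungroup_pe [simp]: "ungroup (pe r (pe (pe x am) (pe y bm))) = pe (pe r (pe am bm)) (pe x y)"
  by (simp add: ungroup_def)

lemma relabeling_regroup:
  "relabeling regroup ungroup ((R \<otimes>\<^sub>s AM \<otimes>\<^sub>s BM) \<otimes>\<^sub>s A \<otimes>\<^sub>s B) (R \<otimes>\<^sub>s (A \<otimes>\<^sub>s AM) \<otimes>\<^sub>s B \<otimes>\<^sub>s BM)"
  unfolding relabeling_def
proof (intro conjI allI)
  fix m
  obtain r am bm x y where m: "m = pe (pe r (pe am bm)) (pe x y)" using pe_exhaust by metis
  then show "ungroup (regroup m) = m"
    "regroup m \<in> R \<otimes>\<^sub>s (A \<otimes>\<^sub>s AM) \<otimes>\<^sub>s B \<otimes>\<^sub>s BM \<longleftrightarrow> m \<in> (R \<otimes>\<^sub>s AM \<otimes>\<^sub>s BM) \<otimes>\<^sub>s A \<otimes>\<^sub>s B"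
    by auto
next
  fix m
  obtain r am bm x y where m: "m = pe r (pe (pe x am) (pe y bm))" using pe_exhaust by metis
  then show "regroup (ungroup m) = m" by simp
qed

lemma idt_lift_mid:
  "idt R (lift_mid AM BM E) X = reindex ungroup (idt (R \<otimes>\<^sub>s AM \<otimes>\<^sub>s BM) E (reindex regroup X))"
proof (intro ext)
  fix m n
  obtain r a am b bm where m: "m = pe r (pe (pe a am) (pe b bm))" using pe_exhaust by metis
  obtain r' a' am' b' bm' where n: "n = pe r' (pe (pe a' am') (pe b' bm'))" using pe_exhaust by metis
  show "idt R (lift_mid AM BM E) X m n = reindex ungroup (idt (R \<otimes>\<^sub>s AM \<otimes>\<^sub>s BM) E (reindex regroup X)) m n"
    unfolding m n by (simp add: lift_mid_pe reindex_def)
qed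

lemma is_map_lift_mid:
  assumes "is_map (A' \<otimes>\<^sub>s B') (A \<otimes>\<^sub>s B) E"
  shows "is_map ((A' \<otimes>\<^sub>s AM) \<otimes>\<^sub>s B' \<otimes>\<^sub>s BM) ((A \<otimes>\<^sub>s AM) \<otimes>\<^sub>s B \<otimes>\<^sub>s BM) (lift_mid AM BM E)"
proof -
  have slice: "op_on (A' \<otimes>\<^sub>s B') (\<lambda>p q. X (with_memory am bm p) (with_memory am' bm' q))"
    if "op_on ((A' \<otimes>\<^sub>s AM) \<otimes>\<^sub>s B' \<otimes>\<^sub>s BM) X" for X am bm am' bm'
  proof -
    have "X i j = 0" if "i \<notin> (A' \<otimes>\<^sub>s AM) \<otimes>\<^sub>s B' \<otimes>\<^sub>s BM \<or> j \<notin> (A' \<otimes>\<^sub>s AM) \<otimes>\<^sub>s B' \<otimes>\<^sub>s BM" for i j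
      using \<open>op_on _ X\<close> that unfolding op_on_def by blast
    then show ?thesis unfolding op_on_tensor_iff by auto
  qed
  show ?thesis
  proof (rule is_mapI)
    fix X assume "op_on ((A' \<otimes>\<^sub>s AM) \<otimes>\<^sub>s B' \<otimes>\<^sub>s BM) X"
    note out = is_map_op_on[OF assms slice[OF this]]
    show "op_on ((A \<otimes>\<^sub>s AM) \<otimes>\<^sub>s B \<otimes>\<^sub>s BM) (lift_mid AM BM E X)"
      unfolding op_on_def
    proof (intro allI impI)
      fix m n assume mn: "m \<notin> (A \<otimes>\<^sub>s AM) \<otimes>\<^sub>s B \<otimes>\<^sub>s BM \<or> n \<notin> (A \<otimes>\<^sub>s AM) \<otimes>\<^sub>s B \<otimes>\<^sub>s BM"
      obtain a am b bm where m: "m = pe (pe a am) (pe b bm)" by (rule pe4_exhaust)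
      obtain a' am' b' bm' where n: "n = pe (pe a' am') (pe b' bm')" by (rule pe4_exhaust)
      show "lift_mid AM BM E X m n = 0"
        using mn out[of am bm am' bm'] unfolding m n lift_mid_pe op_on_def by auto
    qed
  next
    fix X Y assume "op_on ((A' \<otimes>\<^sub>s AM) \<otimes>\<^sub>s B' \<otimes>\<^sub>s BM) X" "op_on ((A' \<otimes>\<^sub>s AM) \<otimes>\<^sub>s B' \<otimes>\<^sub>s BM) Y"
    note add = is_map_add[OF assms slice[OF this(1)] slice[OF this(2)]]
    show "lift_mid AM BM E (\<lambda>i j. X i j + Y i j) = (\<lambda>i j. lift_mid AM BM E X i j + lift_mid AM BM E Y i j)"
      by (rule op_pe4_eqI) (simp add: lift_mid_pe add)
  next
    fix c X assume "op_on ((A' \<otimes>\<^sub>s AM) \<otimes>\<^sub>s B' \<otimes>\<^sub>s BM) X"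
    note scale = is_map_scale[OF assms slice[OF this]]
    show "lift_mid AM BM E (\<lambda>i j. c * X i j) = (\<lambda>i j. c * lift_mid AM BM E X i j)"
      by (rule op_pe4_eqI) (simp add: lift_mid_pe scale)
  qed
qed

lemma CP_lift_mid:
  assumes "CP (A' \<otimes>\<^sub>s B') (A \<otimes>\<^sub>s B) E" "finite AM" "finite BM"
  shows "CP ((A' \<otimes>\<^sub>s AM) \<otimes>\<^sub>s B' \<otimes>\<^sub>s BM) ((A \<otimes>\<^sub>s AM) \<otimes>\<^sub>s B \<otimes>\<^sub>s BM) (lift_mid AM BM E)"
  unfolding CP_def
proof (intro conjI allI impI)
  show "is_map ((A' \<otimes>\<^sub>s AM) \<otimes>\<^sub>s B' \<otimes>\<^sub>s BM) ((A \<otimes>\<^sub>s AM) \<otimes>\<^sub>s B \<otimes>\<^sub>s BM) (lift_mid AM BM E)"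
    by (rule is_map_lift_mid[OF CP_is_map[OF assms(1)]])
  fix R X assume "finite R" "psd (R \<otimes>\<^sub>s (A' \<otimes>\<^sub>s AM) \<otimes>\<^sub>s B' \<otimes>\<^sub>s BM) X"
  then have "psd ((R \<otimes>\<^sub>s AM \<otimes>\<^sub>s BM) \<otimes>\<^sub>s A \<otimes>\<^sub>s B) (idt (R \<otimes>\<^sub>s AM \<otimes>\<^sub>s BM) E (reindex regroup X))"
    using assms by (intro CP_psd[OF assms(1)] psd_reindex[OF relabeling_regroup]) simp_all
  then show "psd (R \<otimes>\<^sub>s (A \<otimes>\<^sub>s AM) \<otimes>\<^sub>s B \<otimes>\<^sub>s BM) (idt R (lift_mid AM BM E) X)"
    unfolding idt_lift_mid by (rule psd_reindex[OF relabeling_sym[OF relabeling_regroup]])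
qed

section \<open>Feasibility of the transformed map\<close>

lemma log_neg_le_0_iff:
  assumes "finite A'" "finite B'" "finite A" "finite B" "is_map (A' \<otimes>\<^sub>s B') (A \<otimes>\<^sub>s B) M"
  shows "log_neg A' B' A B M \<le> 0 \<longleftrightarrow> diamond_norm (A' \<otimes>\<^sub>s B') (A \<otimes>\<^sub>s B) (ptB \<circ> M \<circ> ptB) \<le> 1"
proof -
  have "0 \<le> diamond_norm (A' \<otimes>\<^sub>s B') (A \<otimes>\<^sub>s B) (ptB \<circ> M \<circ> ptB)"
    using assms by (intro diamond_norm_nonneg is_map_ptB_conj) simp_all
  then consider "diamond_norm (A' \<otimes>\<^sub>s B') (A \<otimes>\<^sub>s B) (ptB \<circ> M \<circ> ptB) = 0"
    | "diamond_norm (A' \<otimes>\<^sub>s B') (A \<otimes>\<^sub>s B) (ptB \<circ> M \<circ> ptB) > 0" by linarith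
  \<comment> \<open>Norm zero is treated apart: \<open>log 2 0\<close> is 0 by convention, which
    agrees with the claimed equivalence.\<close>
  then show ?thesis
    unfolding log_neg_def by cases (simp add: log_def, simp)
qed

text \<open>Between consecutive stages two partial transposes are inserted, whose composition is the
  identity.\<close>

lemma ptB_superchannel:
  "ptB \<circ> superchannel_apply Ppre Ppost AM BM M \<circ> ptB
    = (ptB \<circ> Ppost \<circ> ptB) \<circ> (lift_mid AM BM (ptB \<circ> M \<circ> ptB) \<circ> (ptB \<circ> Ppre \<circ> ptB))"
  by (rule ext) (simp add: superchannel_apply_def ptB_lift_mid[symmetric])

lemma log_neg_superchannel_le_0:
  assumes fin: "finite A'" "finite B'" "finite Ah'" "finite Bh'" "finite AM" "finite BM"
        "finite Ah" "finite Bh" "finite A" "finite B"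
    and M: "is_map (Ah' \<otimes>\<^sub>s Bh') (Ah \<otimes>\<^sub>s Bh) M" "log_neg Ah' Bh' Ah Bh M \<le> 0"
    and pre: "completely_PPT_preserving A' B' (Ah' \<otimes>\<^sub>s AM) (Bh' \<otimes>\<^sub>s BM) Ppre"
    and post: "completely_PPT_preserving (Ah \<otimes>\<^sub>s AM) (Bh \<otimes>\<^sub>s BM) A B Ppost"
  shows "log_neg A' B' A B (superchannel_apply Ppre Ppost AM BM M) \<le> 0"
proof -
  define C where "C = A' \<otimes>\<^sub>s B'"
  define \<Phi> where "\<Phi> = ptB \<circ> M \<circ> ptB"
  define P where "P = ptB \<circ> Ppre \<circ> ptB"
  define Q where "Q = ptB \<circ> Ppost \<circ> ptB"
  have finC: "finite C" using fin by (simp add: C_def)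
  have \<Phi>: "is_map (Ah' \<otimes>\<^sub>s Bh') (Ah \<otimes>\<^sub>s Bh) \<Phi>"
    unfolding \<Phi>_def by (rule is_map_ptB_conj[OF M(1)])
  have \<Phi>1: "diamond_norm (Ah' \<otimes>\<^sub>s Bh') (Ah \<otimes>\<^sub>s Bh) \<Phi> \<le> 1"
    using M(2) log_neg_le_0_iff[OF fin(3,4,7,8) M(1)] by (simp add: \<Phi>_def)
  have P: "channel C ((Ah' \<otimes>\<^sub>s AM) \<otimes>\<^sub>s Bh' \<otimes>\<^sub>s BM) P"
    unfolding P_def C_def by (rule completely_PPT_preserving_channels(2)[OF pre])
  have Q: "channel ((Ah \<otimes>\<^sub>s AM) \<otimes>\<^sub>s Bh \<otimes>\<^sub>s BM) (A \<otimes>\<^sub>s B) Q"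
    unfolding Q_def by (rule completely_PPT_preserving_channels(2)[OF post])
  have PC: "channel (C \<otimes>\<^sub>s C) (C \<otimes>\<^sub>s (Ah' \<otimes>\<^sub>s AM) \<otimes>\<^sub>s Bh' \<otimes>\<^sub>s BM) (idt C P)"
    by (rule channel_idt[OF P finC])
  have QC: "channel (C \<otimes>\<^sub>s (Ah \<otimes>\<^sub>s AM) \<otimes>\<^sub>s Bh \<otimes>\<^sub>s BM) (C \<otimes>\<^sub>s A \<otimes>\<^sub>s B) (idt C Q)"
    by (rule channel_idt[OF Q finC])
  have "diamond_norm C (A \<otimes>\<^sub>s B) (Q \<circ> (lift_mid AM BM \<Phi> \<circ> P)) \<le> 1"
  proof (rule diamond_norm_least[OF finC])
    fix X assume X: "op_on (C \<otimes>\<^sub>s C) X" "trace_norm (C \<otimes>\<^sub>s C) X \<le> 1"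
    \<comment> \<open>\<open>X2\<close> moves the memories into the reference so that the bound on
      \<open>\<Phi>\<close> applies, and \<open>X4\<close> moves them back.\<close>
    define X1 where "X1 = idt C P X"
    define X2 where "X2 = reindex regroup X1"
    define X3 where "X3 = idt (C \<otimes>\<^sub>s AM \<otimes>\<^sub>s BM) \<Phi> X2"
    define X4 where "X4 = reindex ungroup X3"
    have X1: "op_on (C \<otimes>\<^sub>s (Ah' \<otimes>\<^sub>s AM) \<otimes>\<^sub>s Bh' \<otimes>\<^sub>s BM) X1"
      unfolding X1_def by (rule is_map_op_on[OF channel_is_map[OF PC] X(1)])
    have X2: "op_on ((C \<otimes>\<^sub>s AM \<otimes>\<^sub>s BM) \<otimes>\<^sub>s Ah' \<otimes>\<^sub>s Bh') X2"
      unfolding X2_def by (rule op_on_reindex[OF relabeling_regroup X1])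
    have X3: "op_on ((C \<otimes>\<^sub>s AM \<otimes>\<^sub>s BM) \<otimes>\<^sub>s Ah \<otimes>\<^sub>s Bh) X3"
      unfolding X3_def by (rule is_map_op_on[OF is_map_idt[OF \<Phi>] X2])
    have X4: "op_on (C \<otimes>\<^sub>s (Ah \<otimes>\<^sub>s AM) \<otimes>\<^sub>s Bh \<otimes>\<^sub>s BM) X4"
      unfolding X4_def by (rule op_on_reindex[OF relabeling_sym[OF relabeling_regroup] X3])
    have "trace_norm (C \<otimes>\<^sub>s A \<otimes>\<^sub>s B) (idt C Q X4) \<le> trace_norm (C \<otimes>\<^sub>s (Ah \<otimes>\<^sub>s AM) \<otimes>\<^sub>s Bh \<otimes>\<^sub>s BM) X4"
      using fin finC by (intro channel_trace_norm_le[OF _ _ QC X4]) simp_all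
    also have "\<dots> \<le> trace_norm ((C \<otimes>\<^sub>s AM \<otimes>\<^sub>s BM) \<otimes>\<^sub>s Ah \<otimes>\<^sub>s Bh) X3"
      unfolding X4_def using fin finC
      by (intro trace_norm_reindex_le[OF relabeling_sym[OF relabeling_regroup] _ _ X3]) simp_all
    also have "\<dots> \<le> trace_norm ((C \<otimes>\<^sub>s AM \<otimes>\<^sub>s BM) \<otimes>\<^sub>s Ah' \<otimes>\<^sub>s Bh') X2"
      unfolding X3_def using fin finC by (intro diamond_norm_stable[OF _ _ _ \<Phi> \<Phi>1 X2]) simp_all
    also have "\<dots> \<le> trace_norm (C \<otimes>\<^sub>s (Ah' \<otimes>\<^sub>s AM) \<otimes>\<^sub>s Bh' \<otimes>\<^sub>s BM) X1"
      unfolding X2_def using fin finC by (intro trace_norm_reindex_le[OF relabeling_regroup _ _ X1]) simp_all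
    also have "\<dots> \<le> trace_norm (C \<otimes>\<^sub>s C) X"
      unfolding X1_def using fin finC by (intro channel_trace_norm_le[OF _ _ PC X(1)]) simp_all
    also have "\<dots> \<le> 1" by (rule X(2))
    finally show "trace_norm (C \<otimes>\<^sub>s A \<otimes>\<^sub>s B) (idt C (Q \<circ> (lift_mid AM BM \<Phi> \<circ> P)) X) \<le> 1"
      by (simp only: idt_comp idt_lift_mid X1_def X2_def X3_def X4_def)
  qed
  then have "diamond_norm (A' \<otimes>\<^sub>s B') (A \<otimes>\<^sub>s B) (ptB \<circ> superchannel_apply Ppre Ppost AM BM M \<circ> ptB) \<le> 1"
    by (simp only: ptB_superchannel C_def \<Phi>_def P_def Q_def)
  moreover have "is_map (A' \<otimes>\<^sub>s B') (A \<otimes>\<^sub>s B) (superchannel_apply Ppre Ppost AM BM M)"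
    unfolding superchannel_apply_def
    by (rule is_map_comp[OF channel_is_map[OF completely_PPT_preserving_channels(1)[OF pre]]
        is_map_comp[OF is_map_lift_mid[OF M(1)] channel_is_map[OF completely_PPT_preserving_channels(1)[OF post]]]])
  ultimately show ?thesis
    using log_neg_le_0_iff[OF fin(1,2,9,10)] by blast
qed

subsection \<open>Mixed states as images of pure states under a channel on the reference\<close>

definition kraus :: "'i set \<Rightarrow> nat set \<Rightarrow> nat set \<Rightarrow> ('i \<Rightarrow> nat \<Rightarrow> nat \<Rightarrow> complex) \<Rightarrow> qmap" where
  "kraus I S T K X = (\<lambda>b b'. if b \<in> T \<and> b' \<in> T
     then \<Sum>k\<in>I. \<Sum>a\<in>S. \<Sum>a'\<in>S. K k b a * X a a' * cnj (K k b' a') else 0)"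

lemma psd_sum_outer:
  assumes "finite I"
  shows "psd S (\<lambda>i j. \<Sum>k\<in>I. outer S (w k) (w k) i j)"
proof -
  have "qf S (\<lambda>i j. \<Sum>k\<in>I. outer S (w k) (w k) i j) v = (\<Sum>k\<in>I. qf S (outer S (w k) (w k)) v)" for v
    unfolding qf_def by (simp add: sum_distrib_left sum_distrib_right sum.swap[of _ I])
  moreover have "Im (qf S (outer S (w k) (w k)) v) = 0" "Re (qf S (outer S (w k) (w k)) v) \<ge> 0" for k v
    using psd_outer[of S "w k"] by (simp_all add: psd_iff_qpos qpos_def)
  ultimately show ?thesis
    by (simp add: psd_iff_qpos qpos_def op_on_sum sum_nonneg)
qed

lemma is_map_kraus: "is_map S T (kraus I S T K)"
proof (rule is_mapI)
  fix X :: op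
  show "op_on T (kraus I S T K X)" by (simp add: op_on_def kraus_def)
next
  fix X Y :: op
  show "kraus I S T K (\<lambda>i j. X i j + Y i j) = (\<lambda>i j. kraus I S T K X i j + kraus I S T K Y i j)"
    by (intro ext) (simp add: kraus_def distrib_left distrib_right sum.distrib)
next
  fix c and X :: op
  show "kraus I S T K (\<lambda>i j. c * X i j) = (\<lambda>i j. c * kraus I S T K X i j)"
    by (intro ext) (simp add: kraus_def sum_distrib_left mult_ac)
qed

text \<open>Applying each Kraus operator to the system part of each Gram vector of the input gives
  Gram vectors \<open>y\<close> of the output.\<close>

lemma CP_kraus:
  assumes "finite I" "finite S" "finite T"
  shows "CP S T (kraus I S T K)"
  unfolding CP_def
proof (intro conjI allI impI)
  show "is_map S T (kraus I S T K)" by (rule is_map_kraus)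
  fix R X assume R: "finite R" and X: "psd (R \<otimes>\<^sub>s S) X"
  define J where "J = R \<otimes>\<^sub>s S"
  have finJ: "finite J" using R assms by (simp add: J_def)
  obtain x where x: "\<And>i j. i \<in> J \<Longrightarrow> j \<in> J \<Longrightarrow> X i j = (\<Sum>l\<in>J. x l i * cnj (x l j))"
    using psd_gram[OF finJ, of X] X unfolding J_def by blast
  define y where "y p m = (case prod_decode m of (r, b) \<Rightarrow> \<Sum>a\<in>S. K (fst p) b a * x (snd p) (pe r a))" for p m
  have "idt R (kraus I S T K) X = (\<lambda>m n. \<Sum>p\<in>I \<times> J. outer (R \<otimes>\<^sub>s T) (y p) (y p) m n)"
  proof (rule op_pe_eqI)
    fix r b r' b'
    show "idt R (kraus I S T K) X (pe r b) (pe r' b') = (\<Sum>p\<in>I \<times> J. outer (R \<otimes>\<^sub>s T) (y p) (y p) (pe r b) (pe r' b'))"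
    proof (cases "r \<in> R \<and> r' \<in> R \<and> b \<in> T \<and> b' \<in> T")
      case True
      have "(\<Sum>a\<in>S. \<Sum>a'\<in>S. K k b a * X (pe r a) (pe r' a') * cnj (K k b' a'))
        = (\<Sum>l\<in>J. y (k, l) (pe r b) * cnj (y (k, l) (pe r' b')))" for k
      proof -
        have "(\<Sum>a\<in>S. \<Sum>a'\<in>S. K k b a * X (pe r a) (pe r' a') * cnj (K k b' a'))
          = (\<Sum>a\<in>S. \<Sum>a'\<in>S. \<Sum>l\<in>J. (K k b a * x l (pe r a)) * cnj (K k b' a' * x l (pe r' a')))"
          using True x by (intro sum.cong refl) (simp add: J_def sum_distrib_left sum_distrib_right mult_ac)
        also have "\<dots> = (\<Sum>l\<in>J. \<Sum>a\<in>S. \<Sum>a'\<in>S. (K k b a * x l (pe r a)) * cnj (K k b' a' * x l (pe r' a')))"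
          by (simp only: sum.swap[of _ J S])
        also have "\<dots> = (\<Sum>l\<in>J. y (k, l) (pe r b) * cnj (y (k, l) (pe r' b')))"
          by (simp add: y_def sum_product)
        finally show ?thesis .
      qed
      then have "idt R (kraus I S T K) X (pe r b) (pe r' b')
          = (\<Sum>k\<in>I. \<Sum>l\<in>J. y (k, l) (pe r b) * cnj (y (k, l) (pe r' b')))"
        using True by (simp add: kraus_def)
      also have "\<dots> = (\<Sum>p\<in>I \<times> J. outer (R \<otimes>\<^sub>s T) (y p) (y p) (pe r b) (pe r' b'))"
        using True by (simp add: sum.cartesian_product outer_def case_prod_beta)
      finally show ?thesis .
    next
      case False
      then show ?thesis by (auto simp: kraus_def outer_def intro!: sum.neutral[symmetric])
    qed
  qed
  then show "psd (R \<otimes>\<^sub>s T) (idt R (kraus I S T K) X)"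
    using psd_sum_outer[of "I \<times> J" "R \<otimes>\<^sub>s T" y] assms(1) finJ by simp
qed

lemma channel_kraus:
  assumes "finite I" "finite S" "finite T"
    and "\<And>a a'. a \<in> S \<Longrightarrow> a' \<in> S \<Longrightarrow> (\<Sum>k\<in>I. \<Sum>b\<in>T. K k b a * cnj (K k b a')) = (if a = a' then 1 else 0)"
  shows "channel S T (kraus I S T K)"
  unfolding channel_def TP_def
proof (intro conjI allI impI)
  show "CP S T (kraus I S T K)" by (rule CP_kraus[OF assms(1-3)])
  fix X assume "op_on S X"
  have "trace T (kraus I S T K X) = (\<Sum>b\<in>T. \<Sum>k\<in>I. \<Sum>a\<in>S. \<Sum>a'\<in>S. X a a' * (K k b a * cnj (K k b a')))"
    unfolding trace_def by (intro sum.cong refl) (simp add: kraus_def mult_ac)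
  also have "\<dots> = (\<Sum>k\<in>I. \<Sum>b\<in>T. \<Sum>a\<in>S. \<Sum>a'\<in>S. X a a' * (K k b a * cnj (K k b a')))"
    by (rule sum.swap)
  also have "\<dots> = (\<Sum>a\<in>S. \<Sum>a'\<in>S. \<Sum>k\<in>I. \<Sum>b\<in>T. X a a' * (K k b a * cnj (K k b a')))"
    by (simp only: sum.swap[of _ S T] sum.swap[of _ S I])
  also have "\<dots> = (\<Sum>a\<in>S. \<Sum>a'\<in>S. X a a' * (\<Sum>k\<in>I. \<Sum>b\<in>T. K k b a * cnj (K k b a')))"
    by (simp only: sum_distrib_left)
  also have "\<dots> = (\<Sum>a\<in>S. \<Sum>a'\<in>S. if a' = a then X a a' else 0)"
    by (intro sum.cong refl) (auto simp: assms(4))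
  also have "\<dots> = trace S X" using assms(2) by (simp add: trace_def)
  finally show "trace T (kraus I S T K X) = trace S X" .
qed

definition swap :: "nat \<Rightarrow> nat" where
  "swap m = (case prod_decode m of (a, b) \<Rightarrow> pe b a)"

lemma swap_pe [simp]: "swap (pe a b) = pe b a"
  by (simp add: swap_def)

lemma relabeling_swap: "relabeling swap swap (S \<otimes>\<^sub>s T) (T \<otimes>\<^sub>s S)"
  unfolding relabeling_pe_iff by auto

definition on_reference :: "nat set \<Rightarrow> qmap \<Rightarrow> qmap" where
  "on_reference T E = reindex swap \<circ> (idt T E \<circ> reindex swap)"

lemma on_reference_pe: "on_reference T E X (pe r b) (pe r' b') =
    (if b \<in> T \<and> b' \<in> T then E (\<lambda>s s'. X (pe s b) (pe s' b')) r r' else 0)"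
  by (simp add: on_reference_def reindex_def)

lemma channel_on_reference:
  assumes "channel S R E" "finite T"
  shows "channel (S \<otimes>\<^sub>s T) (R \<otimes>\<^sub>s T) (on_reference T E)"
  unfolding on_reference_def
  by (rule channel_comp[OF channel_comp[OF channel_reindex[OF relabeling_swap] channel_idt[OF assms]]
        channel_reindex[OF relabeling_swap]])

text \<open>A Gram decomposition of \<open>\<rho>\<close>, factored along \<open>C\<close> by Gram-Schmidt as \<open>L\<close> times \<open>V\<close>, yields both
  the pure state (from \<open>L\<close>) and Kraus operators on the reference (from \<open>V\<close>).  The directions of
  the reference outside \<open>N\<close>, which the pure state does not reach, are sent to a fixed basis state.\<close>

lemma state_as_reference_channel:
  assumes "finite R" "finite C" "finite T" "is_state (R \<otimes>\<^sub>s C) \<rho>"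
  obtains \<psi> \<Lambda> where "pure_state (C \<otimes>\<^sub>s C) \<psi>" "channel (C \<otimes>\<^sub>s T) (R \<otimes>\<^sub>s T) \<Lambda>"
    "\<And>E. is_map C T E \<Longrightarrow> \<Lambda> (idt C E \<psi>) = idt R E \<rho>"
proof -
  define K where "K = R \<otimes>\<^sub>s C"
  have finK: "finite K" using assms by (simp add: K_def)
  have \<rho>: "psd K \<rho>" "trace K \<rho> = 1" using assms(4) by (simp_all add: is_state_def K_def)
  obtain w where w: "\<And>i j. i \<in> K \<Longrightarrow> j \<in> K \<Longrightarrow> \<rho> i j = (\<Sum>k\<in>K. w k i * cnj (w k j))"
    using psd_gram[OF finK \<rho>(1)] by blast
  \<comment> \<open>Unit trace excludes an empty system and so supplies a basis state
    \<open>r0\<close>, the target used to complete the channel.\<close>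
  have "K \<noteq> {}" using \<rho>(2) by (auto simp: trace_def)
  then obtain r0 where r0: "r0 \<in> R" unfolding K_def by (auto simp: sys_tensor_def)
  \<comment> \<open>The index \<open>k\<close> of the Gram vectors acts as a purifying label: the
    columns \<open>(k, r)\<close> of \<open>W\<close> form the reference of a purification of
    \<open>\<rho>\<close>, the rows its system \<open>C\<close>.\<close>
  define W where "W c j = w (fst j) (pe (snd j) c)" for c and j :: "nat \<times> nat"
  obtain L V N where F: "coisometric_factorization C (K \<times> R) W L V N"
    using gram_schmidt[of C "K \<times> R" W] assms(1,2) finK by auto
  note N = coisometric_factorizationD(1)[OF F] and WLV = coisometric_factorizationD(2)[OF F]
    and L0 = coisometric_factorizationD(3)[OF F] and V = coisometric_factorizationD(4)[OF F]
  define v where "v m = (case prod_decode m of (k, c) \<Rightarrow> L c k)" for m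
  define \<psi> where "\<psi> = outer (C \<otimes>\<^sub>s C) v v"
  \<comment> \<open>Orthonormality of the rows of \<open>V\<close> gives \<open>v\<close> the norm
    of \<open>W\<close>, whose square is the trace of \<open>\<rho>\<close>.\<close>
  have "nrm2 (C \<otimes>\<^sub>s C) v = (\<Sum>c\<in>C. nrm2 C (L c))"
    unfolding nrm2_def sum_tensor by (subst sum.swap) (simp add: v_def)
  also have "\<dots> = (\<Sum>c\<in>C. nrm2 N (L c))"
    unfolding nrm2_def using assms(2) N by (intro sum.cong refl sum.mono_neutral_right) (auto simp: L0)
  also have "\<dots> = (\<Sum>c\<in>C. nrm2 (K \<times> R) (\<lambda>j. \<Sum>k\<in>C. L c k * V k j))"
    by (intro sum.cong refl orthonormal_rows_norm[OF assms(2) N V, symmetric])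
  also have "\<dots> = (\<Sum>c\<in>C. nrm2 (K \<times> R) (W c))"
    unfolding nrm2_def by (intro sum.cong refl) (simp add: WLV)
  finally have "complex_of_real (nrm2 (C \<otimes>\<^sub>s C) v) = (\<Sum>c\<in>C. \<Sum>k\<in>K. \<Sum>r\<in>R. w k (pe r c) * cnj (w k (pe r c)))"
    by (simp add: nrm2_complex W_def sum.cartesian_product')
  also have "\<dots> = (\<Sum>r\<in>R. \<Sum>c\<in>C. \<Sum>k\<in>K. w k (pe r c) * cnj (w k (pe r c)))"
    by (simp only: sum.swap[of _ R K] sum.swap[of _ R C])
  also have "\<dots> = trace K \<rho>"
    unfolding trace_def K_def sum_tensor using w by (intro sum.cong refl) (simp add: K_def sum_tensor)
  finally have "nrm2 (C \<otimes>\<^sub>s C) v = 1" using \<rho>(2) by simp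
  then have pure: "pure_state (C \<otimes>\<^sub>s C) \<psi>"
    unfolding pure_state_def \<psi>_def outer_def nrm2_def by blast
  \<comment> \<open>The operator \<open>Inl k\<close> carries the reference along \<open>V\<close>
    and selects the value \<open>k\<close> of the purifying label; summing over \<open>k\<close>
    discards that label. \<open>Inr c0\<close> sends the state \<open>c0\<close> outside
    \<open>N\<close> to \<open>r0\<close>.\<close>
  define I where "I = K <+> (C - N)"
  define Q where "Q = (\<lambda>i r c. case i of Inl k \<Rightarrow> V c (k, r) | Inr c0 \<Rightarrow> if r = r0 \<and> c = c0 then 1 else (0::complex))"
  have sumI: "(\<Sum>i\<in>I. f i) = (\<Sum>k\<in>K. f (Inl k)) + (\<Sum>c\<in>C - N. f (Inr c))" for f :: "nat + nat \<Rightarrow> complex"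
    using finK assms(2) by (simp add: I_def sum.Plus)
  have chan: "channel C R (kraus I C R Q)"
  proof (rule channel_kraus)
    show "finite I" "finite C" "finite R" using finK assms by (simp_all add: I_def)
    fix c c' assume c: "c \<in> C" "c' \<in> C"
    have "(\<Sum>k\<in>K. \<Sum>r\<in>R. Q (Inl k) r c * cnj (Q (Inl k) r c')) = (\<Sum>j\<in>K \<times> R. V c j * cnj (V c' j))"
      by (simp add: Q_def sum.cartesian_product')
    moreover have "(\<Sum>r\<in>R. Q (Inr c0) r c * cnj (Q (Inr c0) r c')) = (if c0 = c then if c = c' then 1 else 0 else 0)" for c0
    proof -
      have "(\<Sum>r\<in>R. Q (Inr c0) r c * cnj (Q (Inr c0) r c'))
          = (\<Sum>r\<in>R. if r = r0 then if c = c0 \<and> c' = c0 then 1 else 0 else 0)"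
        by (intro sum.cong) (auto simp: Q_def)
      then show ?thesis using assms(1) r0 by auto
    qed
    ultimately show "(\<Sum>i\<in>I. \<Sum>r\<in>R. Q i r c * cnj (Q i r c')) = (if c = c' then 1 else 0)"
      using c assms(2) by (simp add: sumI V)
  qed
  define \<Lambda> where "\<Lambda> = on_reference T (kraus I C R Q)"
  have "\<Lambda> (idt C E \<psi>) = idt R E \<rho>" if E: "is_map C T E" for E
  proof (rule op_pe_eqI)
    fix r t r' t'
    show "\<Lambda> (idt C E \<psi>) (pe r t) (pe r' t') = idt R E \<rho> (pe r t) (pe r' t')"
    proof (cases "r \<in> R \<and> r' \<in> R \<and> t \<in> T \<and> t' \<in> T")
      case True
      define Z where "Z c c' = outer C (\<lambda>s. L s c) (\<lambda>s. L s c')" for c c'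
      define e where "e c c' = E (Z c c') t t'" for c c'
      have slice: "idt C E \<psi> (pe c t) (pe c' t') = e c c'" if "c \<in> C" "c' \<in> C" for c c'
      proof -
        have "(\<lambda>s s'. \<psi> (pe c s) (pe c' s')) = Z c c'"
          using that by (intro ext) (simp add: \<psi>_def Z_def outer_def v_def)
        then show ?thesis using that by (simp add: e_def)
      qed
      \<comment> \<open>\<open>\<psi>\<close> has no component on reference states outside
        \<open>N\<close>, so the branches \<open>Inr\<close> contribute nothing.\<close>
      have e0: "e c c' = 0" if "c \<notin> N" for c c'
      proof -
        have "Z c c' = (\<lambda>i j. 0)" using that by (intro ext) (simp add: Z_def outer_def L0)
        then show ?thesis by (simp add: e_def is_map_zero[OF E])
      qed
      have "\<Lambda> (idt C E \<psi>) (pe r t) (pe r' t')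
        = (\<Sum>i\<in>I. \<Sum>c\<in>C. \<Sum>c'\<in>C. Q i r c * e c c' * cnj (Q i r' c'))"
        using True by (simp add: \<Lambda>_def on_reference_pe kraus_def slice del: idt_pe)
      also have "\<dots> = (\<Sum>k\<in>K. \<Sum>c\<in>C. \<Sum>c'\<in>C. V c (k, r) * cnj (V c' (k, r')) * e c c')"
      proof -
        have "(\<Sum>c\<in>C. \<Sum>c'\<in>C. Q (Inr c0) r c * e c c' * cnj (Q (Inr c0) r' c')) = 0" if "c0 \<in> C - N" for c0
          using that by (intro sum.neutral ballI) (auto simp: Q_def e0)
        then show ?thesis by (simp add: sumI) (simp add: Q_def mult_ac)
      qed
      also have "\<dots> = (\<Sum>p\<in>K \<times> C \<times> C. V (fst (snd p)) (fst p, r) * cnj (V (snd (snd p)) (fst p, r')) * e (fst (snd p)) (snd (snd p)))"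
        by (simp add: sum.cartesian_product')
      also have "\<dots> = E (\<lambda>s s'. \<Sum>p\<in>K \<times> C \<times> C. V (fst (snd p)) (fst p, r) * cnj (V (snd (snd p)) (fst p, r'))
          * Z (fst (snd p)) (snd (snd p)) s s') t t'"
        unfolding e_def using finK assms(2) by (subst is_map_sum_scale[OF E]) (simp_all add: Z_def)
      \<comment> \<open>Recombining \<open>L\<close> and \<open>V\<close> returns \<open>W\<close>,
        and with it the Gram decomposition of \<open>\<rho>\<close>.\<close>
      also have "(\<lambda>s s'. \<Sum>p\<in>K \<times> C \<times> C. V (fst (snd p)) (fst p, r) * cnj (V (snd (snd p)) (fst p, r'))
          * Z (fst (snd p)) (snd (snd p)) s s') = (\<lambda>s s'. \<rho> (pe r s) (pe r' s'))"
      proof (intro ext)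
        fix s s'
        show "(\<Sum>p\<in>K \<times> C \<times> C. V (fst (snd p)) (fst p, r) * cnj (V (snd (snd p)) (fst p, r'))
          * Z (fst (snd p)) (snd (snd p)) s s') = \<rho> (pe r s) (pe r' s')"
        proof (cases "s \<in> C \<and> s' \<in> C")
          case s: True
          have "(\<Sum>p\<in>K \<times> C \<times> C. V (fst (snd p)) (fst p, r) * cnj (V (snd (snd p)) (fst p, r'))
              * Z (fst (snd p)) (snd (snd p)) s s')
            = (\<Sum>k\<in>K. \<Sum>c\<in>C. \<Sum>c'\<in>C. (L s c * V c (k, r)) * cnj (L s' c' * V c' (k, r')))"
            using s by (simp add: sum.cartesian_product' Z_def outer_def mult_ac)
          also have "\<dots> = (\<Sum>k\<in>K. W s (k, r) * cnj (W s' (k, r')))"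
            using s True by (intro sum.cong refl) (simp add: WLV sum_product)
          also have "\<dots> = \<rho> (pe r s) (pe r' s')"
            using s True w[of "pe r s" "pe r' s'"] by (simp add: W_def K_def)
          finally show ?thesis .
        next
          case False
          moreover have "op_on K \<rho>" using \<rho>(1) by (simp add: psd_iff_qpos)
          ultimately show ?thesis
            unfolding K_def op_on_tensor_iff by (auto simp: Z_def outer_def intro!: sum.neutral)
        qed
      qed
      finally show ?thesis using True by simp
    next
      case False
      moreover have "op_on K \<rho>" using \<rho>(1) by (simp add: psd_iff_qpos)
      then have "op_on (R \<otimes>\<^sub>s T) (idt R E \<rho>)"
        unfolding K_def by (rule is_map_op_on[OF is_map_idt[OF E]])
      ultimately show ?thesis
        unfolding \<Lambda>_def on_reference_pe op_on_tensor_iff by (auto simp: kraus_def simp del: idt_pe)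
    qed
  qed
  with pure channel_on_reference[OF chan assms(3)] show ?thesis
    using that[of \<psi> \<Lambda>] by (simp add: \<Lambda>_def)
qed

section \<open>Data processing for the channel divergence, and the conclusion\<close>

lemma pure_state_is_state:
  assumes "pure_state S \<psi>"
  shows "is_state S \<psi>"
proof -
  obtain v where v: "nrm2 S v = 1" "\<psi> = outer S v v"
    using assms unfolding pure_state_def nrm2_def outer_def by blast
  have "trace S \<psi> = complex_of_real (nrm2 S v)"
    by (simp add: v(2) trace_def outer_def nrm2_complex)
  then show ?thesis using v psd_outer[of S v] by (simp add: is_state_def)
qed

lemma gen_divergenceD:
  assumes "gen_divergence D" "finite S" "finite T" "channel S T E" "is_state S \<rho>" "psd S \<sigma>"
  shows "D T (E \<rho>) (E \<sigma>) \<le> D S \<rho> \<sigma>"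
  using assms unfolding gen_divergence_def by blast

text \<open>\<open>\<psi>\<close> and \<open>\<Lambda>\<close> are built from \<open>Ppre\<close>
  and the test state, independently of the middle map. One and the same channel therefore yields the
  outputs for \<open>M\<close> and for \<open>M'\<close>, as data processing demands. As
  \<open>M'\<close> need not preserve the trace, \<open>eq\<close> is used for all linear maps, not
  just channels.\<close>

lemma chan_div_superchannel_le:
  assumes D: "gen_divergence D"
    and fin: "finite C" "finite Ah'" "finite Bh'" "finite AM" "finite BM" "finite Ah" "finite Bh" "finite T"
    and M: "channel (Ah' \<otimes>\<^sub>s Bh') (Ah \<otimes>\<^sub>s Bh) M" and M': "CP (Ah' \<otimes>\<^sub>s Bh') (Ah \<otimes>\<^sub>s Bh) M'"
    and pre: "channel C ((Ah' \<otimes>\<^sub>s AM) \<otimes>\<^sub>s Bh' \<otimes>\<^sub>s BM) Ppre"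
    and post: "channel ((Ah \<otimes>\<^sub>s AM) \<otimes>\<^sub>s Bh \<otimes>\<^sub>s BM) T Ppost"
  shows "chan_div D C T (superchannel_apply Ppre Ppost AM BM M) (superchannel_apply Ppre Ppost AM BM M')
    \<le> chan_div D (Ah' \<otimes>\<^sub>s Bh') (Ah \<otimes>\<^sub>s Bh) M M'"
  unfolding chan_div_def[of D C]
proof (rule SUP_least)
  fix \<phi> assume "\<phi> \<in> {\<psi>. pure_state (C \<otimes>\<^sub>s C) \<psi>}"
  then have \<phi>: "is_state (C \<otimes>\<^sub>s C) \<phi>" using pure_state_is_state by blast
  define S where "S = Ah' \<otimes>\<^sub>s Bh'"
  define Q where "Q = Ah \<otimes>\<^sub>s Bh"
  define R where "R = C \<otimes>\<^sub>s AM \<otimes>\<^sub>s BM"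
  have finite: "finite S" "finite Q" "finite R" using fin by (simp_all add: S_def Q_def R_def)
  define \<rho> where "\<rho> = reindex regroup (idt C Ppre \<phi>)"
  have "is_state (C \<otimes>\<^sub>s (Ah' \<otimes>\<^sub>s AM) \<otimes>\<^sub>s Bh' \<otimes>\<^sub>s BM) (idt C Ppre \<phi>)"
    by (rule is_state_idt_channel[OF pre fin(1) \<phi>])
  then have \<rho>: "is_state (R \<otimes>\<^sub>s S) \<rho>"
    unfolding is_state_def \<rho>_def R_def S_def
    using psd_reindex[OF relabeling_regroup] trace_reindex[OF relabeling_regroup] by simp
  obtain \<psi> \<Lambda> where \<psi>: "pure_state (S \<otimes>\<^sub>s S) \<psi>" and \<Lambda>: "channel (S \<otimes>\<^sub>s Q) (R \<otimes>\<^sub>s Q) \<Lambda>"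
    and eq: "\<And>E. is_map S Q E \<Longrightarrow> \<Lambda> (idt S E \<psi>) = idt R E \<rho>"
    by (rule state_as_reference_channel[OF finite(3,1,2) \<rho>], rule that)
  \<comment> \<open>\<open>reindex ungroup\<close> hands the memories back to Alice and Bob before
    \<open>Ppost\<close> acts.\<close>
  have chan: "channel (S \<otimes>\<^sub>s Q) (C \<otimes>\<^sub>s T) (idt C Ppost \<circ> (reindex ungroup \<circ> \<Lambda>))"
    using \<Lambda> unfolding R_def Q_def
    by (intro channel_comp[OF channel_comp[OF _ channel_reindex[OF relabeling_sym[OF relabeling_regroup]]]
          channel_idt[OF post fin(1)]])
  have out: "idt C (superchannel_apply Ppre Ppost AM BM E) \<phi>
      = (idt C Ppost \<circ> (reindex ungroup \<circ> \<Lambda>)) (idt S E \<psi>)" if "is_map S Q E" for E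
    unfolding superchannel_apply_def comp_assoc idt_comp idt_lift_mid comp_apply eq[OF that]
    by (simp add: R_def \<rho>_def)
  have st: "is_state (S \<otimes>\<^sub>s Q) (idt S M \<psi>)"
    using is_state_idt_channel[OF M, of S \<psi>] finite(1) pure_state_is_state[OF \<psi>] by (simp add: S_def Q_def)
  have pos: "psd (S \<otimes>\<^sub>s Q) (idt S M' \<psi>)"
    using CP_psd[OF M', of S \<psi>] finite(1) pure_state_is_state[OF \<psi>] by (simp add: S_def Q_def is_state_def)
  have "D (C \<otimes>\<^sub>s T) (idt C (superchannel_apply Ppre Ppost AM BM M) \<phi>)
      (idt C (superchannel_apply Ppre Ppost AM BM M') \<phi>)
    = D (C \<otimes>\<^sub>s T) ((idt C Ppost \<circ> (reindex ungroup \<circ> \<Lambda>)) (idt S M \<psi>))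
      ((idt C Ppost \<circ> (reindex ungroup \<circ> \<Lambda>)) (idt S M' \<psi>))"
    using out[of M] out[of M'] channel_is_map[OF M] CP_is_map[OF M'] by (simp only: S_def Q_def)
  also have "\<dots> \<le> D (S \<otimes>\<^sub>s Q) (idt S M \<psi>) (idt S M' \<psi>)"
    using finite fin by (intro gen_divergenceD[OF D _ _ chan st pos]) simp_all
  also have "\<dots> \<le> chan_div D S Q M M'"
    unfolding chan_div_def using \<psi> by (intro SUP_upper) simp
  finally show "D (C \<otimes>\<^sub>s T) (idt C (superchannel_apply Ppre Ppost AM BM M) \<phi>)
      (idt C (superchannel_apply Ppre Ppost AM BM M') \<phi>) \<le> chan_div D (Ah' \<otimes>\<^sub>s Bh') (Ah \<otimes>\<^sub>s Bh) M M'"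
    by (simp only: S_def Q_def)
qed

theorem mainTheorem5:
  fixes D :: "nat set \<Rightarrow> op \<Rightarrow> op \<Rightarrow> ereal"
    and A' B' Ah' Bh' AM BM Ah Bh A B :: "nat set"
    and M Ppre Ppost :: qmap
  assumes "gen_divergence D"
    and "finite A'" "finite B'" "finite Ah'" "finite Bh'" "finite AM" "finite BM"
        "finite Ah" "finite Bh" "finite A" "finite B"
    and "bipartite_channel Ah' Bh' Ah Bh M"
    and "completely_PPT_preserving A' B' (Ah' \<otimes>\<^sub>s AM) (Bh' \<otimes>\<^sub>s BM) Ppre"
    and "completely_PPT_preserving (Ah \<otimes>\<^sub>s AM) (Bh \<otimes>\<^sub>s BM) A B Ppost"
  shows "rains D Ah' Bh' Ah Bh M \<ge> rains D A' B' A B (superchannel_apply Ppre Ppost AM BM M)"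
proof -
  note fin = assms(2-11)
  have M: "channel (Ah' \<otimes>\<^sub>s Bh') (Ah \<otimes>\<^sub>s Bh) M"
    using assms(12) by (simp add: bipartite_channel_def)
  note pre = completely_PPT_preserving_channels(1)[OF assms(13)]
  note post = completely_PPT_preserving_channels(1)[OF assms(14)]
  show ?thesis
    \<comment> \<open>Only the infimum for \<open>M\<close> is opened: each of its feasible points
      bounds the other infimum through its own image.\<close>
    unfolding rains_def[of D Ah']
  proof (rule INF_greatest)
    fix M' assume "M' \<in> {M'. CP (Ah' \<otimes>\<^sub>s Bh') (Ah \<otimes>\<^sub>s Bh) M' \<and> log_neg Ah' Bh' Ah Bh M' \<le> 0}"
    then have M': "CP (Ah' \<otimes>\<^sub>s Bh') (Ah \<otimes>\<^sub>s Bh) M'" and neg: "log_neg Ah' Bh' Ah Bh M' \<le> 0" by auto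
    let ?N = "superchannel_apply Ppre Ppost AM BM M'"
    have "CP (A' \<otimes>\<^sub>s B') (A \<otimes>\<^sub>s B) (Ppost \<circ> (lift_mid AM BM M' \<circ> Ppre))"
      using pre post unfolding channel_def
      by (intro CP_comp[OF CP_comp[OF _ CP_lift_mid[OF M' fin(5,6)]]]) simp_all
    then have "CP (A' \<otimes>\<^sub>s B') (A \<otimes>\<^sub>s B) ?N" by (simp only: superchannel_apply_def comp_assoc)
    moreover have "log_neg A' B' A B ?N \<le> 0"
      by (rule log_neg_superchannel_le_0[OF fin CP_is_map[OF M'] neg assms(13,14)])
    ultimately have "rains D A' B' A B (superchannel_apply Ppre Ppost AM BM M)
        \<le> chan_div D (A' \<otimes>\<^sub>s B') (A \<otimes>\<^sub>s B) (superchannel_apply Ppre Ppost AM BM M) ?N"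
      unfolding rains_def by (intro INF_lower) simp
    also have "\<dots> \<le> chan_div D (Ah' \<otimes>\<^sub>s Bh') (Ah \<otimes>\<^sub>s Bh) M M'"
      using fin by (intro chan_div_superchannel_le[OF assms(1) _ _ _ _ _ _ _ _ M M' pre post]) simp_all
    finally show "rains D A' B' A B (superchannel_apply Ppre Ppost AM BM M)
        \<le> chan_div D (Ah' \<otimes>\<^sub>s Bh') (Ah \<otimes>\<^sub>s Bh) M M'" .
  qed
qed

end
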